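(* Let $\mathcal A$ be a locally noetherian Grothendieck category and $\mathcal C\subseteq\mathcal A$ be a Serre subcategory. For an object $L\in \mathcal A$, the following are equivalent. (1) The object $L$ is $\mathcal C$-closed, i.e., for any $\mathcal C$-isomorphism $u:A\longrightarrow B$ in $\mathcal A$, the induced morphism $Hom(u,L):Hom(B,L)\longrightarrow Hom(A,L)$ is an isomorphism. (2) For any $\mathcal C$-isomorphism $u':A'\longrightarrow B'$ with $A'$, $B'$ finitely generated, the induced morphism $Hom(u',L):Hom(B',L)\longrightarrow Hom(A',L)$ is an isomorphism.
   Context: A Serre subcategory is a full subcategory closed under subobjects, quotients and extensions. A morphism $u:A\to B$ in $\mathcal A$ is a $\mathcal C$-isomorphism if both $Ker(u)$ and $Coker(u)$ lie in $\mathcal C$. An object $X$ of a Grothendieck category $\mathcal A$ is finitely generated if $Hom_{\mathcal A}(X,-)$ preserves filtered colimits of monomorphisms; an object is noetherian if every subobject of it is finitely generated; $\mathcal A$ is locally noetherian if it has a set of noetherian generators. *)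

theory Defs
  imports "HOL-Algebra.Group" "HOL-Library.Equipollence"
begin

section \<open>Universes and smallness\<close>

text \<open>
  Smallness is relative to a Grothendieck universe, given by a type \<open>'u\<close> whose
  cardinality is an uncountable strongly inaccessible cardinal; the small sets are those of
  cardinality strictly less than that of \<open>'u\<close>, and every small set is in bijection
  with a subset of \<open>'u\<close>. Plain HOL does not prove that such a type exists, just as
  ZFC does not prove that a universe exists; the type of all ZFC sets in an axiomatic
  extension of HOL by ZFC is an instance, with the usual meaning of small set.
\<close>

definition small :: "'u itself \<Rightarrow> 'a set \<Rightarrow> bool" where
  "small U S \<longleftrightarrow> S \<prec> (UNIV :: 'u set)"

locale universe =
  fixes U :: "'u itself"
  assumes small_nat: "small U (UNIV :: nat set)"
    and small_Pow: "\<And>S :: 'u set. small U S \<Longrightarrow> small U (Pow S)"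
    and small_UN: "\<And>(I :: 'u set) (F :: 'u \<Rightarrow> 'u set).
      \<lbrakk>small U I; \<And>i. i \<in> I \<Longrightarrow> small U (F i)\<rbrakk> \<Longrightarrow> small U (\<Union>i\<in>I. F i)"


section \<open>Categories, functors and colimits\<close>

record ('o, 'm) category =
  Ob :: "'o set"
  Ar :: "'m set"
  Dom :: "'m \<Rightarrow> 'o"
  Cod :: "'m \<Rightarrow> 'o"
  Ide :: "'o \<Rightarrow> 'm"
  Comp :: "'m \<Rightarrow> 'm \<Rightarrow> 'm" (infixr "\<cdot>\<index>" 75)

definition Hom :: "('o, 'm, 'z) category_scheme \<Rightarrow> 'o \<Rightarrow> 'o \<Rightarrow> 'm set" where
  "Hom A X Y = {f \<in> Ar A. Dom A f = X \<and> Cod A f = Y}"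

locale category =
  fixes A :: "('o, 'm, 'z) category_scheme" (structure)
  assumes Dom_in_Ob: "f \<in> Ar A \<Longrightarrow> Dom A f \<in> Ob A"
    and Cod_in_Ob: "f \<in> Ar A \<Longrightarrow> Cod A f \<in> Ob A"
    and Ide_in_Hom: "X \<in> Ob A \<Longrightarrow> Ide A X \<in> Hom A X X"
    and Comp_in_Hom: "\<lbrakk>f \<in> Hom A X Y; g \<in> Hom A Y Z\<rbrakk> \<Longrightarrow> g \<cdot> f \<in> Hom A X Z"
    and Comp_Ide: "f \<in> Hom A X Y \<Longrightarrow> f \<cdot> Ide A X = f"
    and Ide_Comp: "f \<in> Hom A X Y \<Longrightarrow> Ide A Y \<cdot> f = f"
    and Comp_assoc: "\<lbrakk>f \<in> Hom A W X; g \<in> Hom A X Y; h \<in> Hom A Y Z\<rbrakk> \<Longrightarrow>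
      (h \<cdot> g) \<cdot> f = h \<cdot> (g \<cdot> f)"

definition monic :: "('o, 'm, 'z) category_scheme \<Rightarrow> 'm \<Rightarrow> bool" where
  "monic A f \<longleftrightarrow> f \<in> Ar A \<and>
    (\<forall>W \<in> Ob A. \<forall>g \<in> Hom A W (Dom A f). \<forall>h \<in> Hom A W (Dom A f).
      f \<cdot>\<^bsub>A\<^esub> g = f \<cdot>\<^bsub>A\<^esub> h \<longrightarrow> g = h)"

definition epic :: "('o, 'm, 'z) category_scheme \<Rightarrow> 'm \<Rightarrow> bool" where
  "epic A f \<longleftrightarrow> f \<in> Ar A \<and>
    (\<forall>Z \<in> Ob A. \<forall>g \<in> Hom A (Cod A f) Z. \<forall>h \<in> Hom A (Cod A f) Z.
      g \<cdot>\<^bsub>A\<^esub> f = h \<cdot>\<^bsub>A\<^esub> f \<longrightarrow> g = h)"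

locale cat_functor = J: category J + A: category A
  for J :: "('i, 'j, 'y) category_scheme" and A :: "('o, 'm, 'z) category_scheme" +
  fixes Fo :: "'i \<Rightarrow> 'o" and Fa :: "'j \<Rightarrow> 'm"
  assumes Fo_in_Ob: "i \<in> Ob J \<Longrightarrow> Fo i \<in> Ob A"
    and Fa_in_Hom: "\<phi> \<in> Hom J i j \<Longrightarrow> Fa \<phi> \<in> Hom A (Fo i) (Fo j)"
    and Fa_Ide: "i \<in> Ob J \<Longrightarrow> Fa (Ide J i) = Ide A (Fo i)"
    and Fa_Comp: "\<lbrakk>\<phi> \<in> Hom J i j; \<psi> \<in> Hom J j k\<rbrakk> \<Longrightarrow>
      Fa (\<psi> \<cdot>\<^bsub>J\<^esub> \<phi>) = Fa \<psi> \<cdot>\<^bsub>A\<^esub> Fa \<phi>"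

definition nat_trans ::
  "('i, 'j, 'y) category_scheme \<Rightarrow> ('o, 'm, 'z) category_scheme \<Rightarrow>
   ('i \<Rightarrow> 'o) \<Rightarrow> ('j \<Rightarrow> 'm) \<Rightarrow> ('i \<Rightarrow> 'o) \<Rightarrow> ('j \<Rightarrow> 'm) \<Rightarrow> ('i \<Rightarrow> 'm) \<Rightarrow> bool" where
  "nat_trans J A Fo Fa Go Ga \<alpha> \<longleftrightarrow>
    (\<forall>i \<in> Ob J. \<alpha> i \<in> Hom A (Fo i) (Go i)) \<and>
    (\<forall>i j. \<forall>\<phi> \<in> Hom J i j. \<alpha> j \<cdot>\<^bsub>A\<^esub> Fa \<phi> = Ga \<phi> \<cdot>\<^bsub>A\<^esub> \<alpha> i)"

definition is_cocone ::
  "('i, 'j, 'y) category_scheme \<Rightarrow> ('o, 'm, 'z) category_scheme \<Rightarrow>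
   ('i \<Rightarrow> 'o) \<Rightarrow> ('j \<Rightarrow> 'm) \<Rightarrow> 'o \<Rightarrow> ('i \<Rightarrow> 'm) \<Rightarrow> bool" where
  "is_cocone J A Fo Fa M \<mu> \<longleftrightarrow> M \<in> Ob A \<and>
    (\<forall>i \<in> Ob J. \<mu> i \<in> Hom A (Fo i) M) \<and>
    (\<forall>i j. \<forall>\<phi> \<in> Hom J i j. \<mu> j \<cdot>\<^bsub>A\<^esub> Fa \<phi> = \<mu> i)"

definition is_colimit ::
  "('i, 'j, 'y) category_scheme \<Rightarrow> ('o, 'm, 'z) category_scheme \<Rightarrow>
   ('i \<Rightarrow> 'o) \<Rightarrow> ('j \<Rightarrow> 'm) \<Rightarrow> 'o \<Rightarrow> ('i \<Rightarrow> 'm) \<Rightarrow> bool" where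
  "is_colimit J A Fo Fa M \<mu> \<longleftrightarrow> is_cocone J A Fo Fa M \<mu> \<and>
    (\<forall>N \<nu>. is_cocone J A Fo Fa N \<nu> \<longrightarrow>
      (\<exists>!m. m \<in> Hom A M N \<and> (\<forall>i \<in> Ob J. m \<cdot>\<^bsub>A\<^esub> \<mu> i = \<nu> i)))"

definition is_coproduct ::
  "('o, 'm, 'z) category_scheme \<Rightarrow> 'i set \<Rightarrow> ('i \<Rightarrow> 'o) \<Rightarrow> 'o \<Rightarrow> ('i \<Rightarrow> 'm) \<Rightarrow> bool" where
  "is_coproduct A I X S \<iota> \<longleftrightarrow> S \<in> Ob A \<and> (\<forall>i \<in> I. \<iota> i \<in> Hom A (X i) S) \<and>
    (\<forall>N \<in> Ob A. \<forall>\<nu>. (\<forall>i \<in> I. \<nu> i \<in> Hom A (X i) N) \<longrightarrow>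
      (\<exists>!m. m \<in> Hom A S N \<and> (\<forall>i \<in> I. m \<cdot>\<^bsub>A\<^esub> \<iota> i = \<nu> i)))"

locale filtered_category = category J for J :: "('i, 'j, 'y) category_scheme" +
  assumes nonempty: "Ob J \<noteq> {}"
    and upper_bound: "\<lbrakk>i \<in> Ob J; j \<in> Ob J\<rbrakk> \<Longrightarrow>
      \<exists>k \<in> Ob J. Hom J i k \<noteq> {} \<and> Hom J j k \<noteq> {}"
    and coequalizing: "\<lbrakk>\<phi> \<in> Hom J i j; \<psi> \<in> Hom J i j\<rbrakk> \<Longrightarrow>
      \<exists>k \<in> Ob J. \<exists>\<chi> \<in> Hom J j k. \<chi> \<cdot>\<^bsub>J\<^esub> \<phi> = \<chi> \<cdot>\<^bsub>J\<^esub> \<psi>"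

text \<open>
  Up to isomorphism, every small category has its objects and arrows in \<open>'u\<close>, so
  small filtered diagrams are indexed by categories of this form.
\<close>

definition small_filtered :: "'u itself \<Rightarrow> ('u, 'u) category \<Rightarrow> bool" where
  "small_filtered U J \<longleftrightarrow> filtered_category J \<and> small U (Ob J) \<and> small U (Ar J)"


section \<open>Abelian categories\<close>

record ('o, 'm) ab_category = "('o, 'm) category" +
  Add :: "'m \<Rightarrow> 'm \<Rightarrow> 'm"
  Zero :: "'o \<Rightarrow> 'o \<Rightarrow> 'm"

definition hom_group :: "('o, 'm, 'z) ab_category_scheme \<Rightarrow> 'o \<Rightarrow> 'o \<Rightarrow> 'm monoid" where
  "hom_group A X Y = \<lparr>carrier = Hom A X Y, mult = Add A, one = Zero A X Y\<rparr>"

definition is_kernel :: "('o, 'm, 'z) ab_category_scheme \<Rightarrow> 'm \<Rightarrow> 'm \<Rightarrow> bool" where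
  "is_kernel A f k \<longleftrightarrow> f \<in> Ar A \<and> k \<in> Ar A \<and> Cod A k = Dom A f \<and>
    f \<cdot>\<^bsub>A\<^esub> k = Zero A (Dom A k) (Cod A f) \<and>
    (\<forall>W \<in> Ob A. \<forall>h \<in> Hom A W (Dom A f). f \<cdot>\<^bsub>A\<^esub> h = Zero A W (Cod A f) \<longrightarrow>
      (\<exists>!g. g \<in> Hom A W (Dom A k) \<and> k \<cdot>\<^bsub>A\<^esub> g = h))"

definition is_cokernel :: "('o, 'm, 'z) ab_category_scheme \<Rightarrow> 'm \<Rightarrow> 'm \<Rightarrow> bool" where
  "is_cokernel A f c \<longleftrightarrow> f \<in> Ar A \<and> c \<in> Ar A \<and> Dom A c = Cod A f \<and>
    c \<cdot>\<^bsub>A\<^esub> f = Zero A (Dom A f) (Cod A c) \<and>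
    (\<forall>Z \<in> Ob A. \<forall>h \<in> Hom A (Cod A f) Z. h \<cdot>\<^bsub>A\<^esub> f = Zero A (Dom A f) Z \<longrightarrow>
      (\<exists>!g. g \<in> Hom A (Cod A c) Z \<and> g \<cdot>\<^bsub>A\<^esub> c = h))"

definition is_zero_object :: "('o, 'm, 'z) ab_category_scheme \<Rightarrow> 'o \<Rightarrow> bool" where
  "is_zero_object A Z \<longleftrightarrow> Z \<in> Ob A \<and>
    (\<forall>X \<in> Ob A. (\<exists>!f. f \<in> Hom A X Z) \<and> (\<exists>!f. f \<in> Hom A Z X))"

definition has_biproduct :: "('o, 'm, 'z) ab_category_scheme \<Rightarrow> 'o \<Rightarrow> 'o \<Rightarrow> bool" where
  "has_biproduct A X Y \<longleftrightarrow>
    (\<exists>P \<in> Ob A. \<exists>i \<in> Hom A X P. \<exists>j \<in> Hom A Y P. \<exists>p \<in> Hom A P X. \<exists>q \<in> Hom A P Y.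
      p \<cdot>\<^bsub>A\<^esub> i = Ide A X \<and> q \<cdot>\<^bsub>A\<^esub> j = Ide A Y \<and>
      Add A (i \<cdot>\<^bsub>A\<^esub> p) (j \<cdot>\<^bsub>A\<^esub> q) = Ide A P)"

locale preadditive_category = category A
  for A :: "('o, 'm, 'z) ab_category_scheme" (structure) +
  assumes comm_group_Hom: "\<lbrakk>X \<in> Ob A; Y \<in> Ob A\<rbrakk> \<Longrightarrow> comm_group (hom_group A X Y)"
    and Comp_Add_left: "\<lbrakk>f \<in> Hom A X Y; g \<in> Hom A Y Z; h \<in> Hom A Y Z\<rbrakk> \<Longrightarrow>
      Add A g h \<cdot> f = Add A (g \<cdot> f) (h \<cdot> f)"
    and Comp_Add_right: "\<lbrakk>f \<in> Hom A X Y; g \<in> Hom A X Y; h \<in> Hom A Y Z\<rbrakk> \<Longrightarrow>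
      h \<cdot> Add A f g = Add A (h \<cdot> f) (h \<cdot> g)"

locale abelian_category = preadditive_category A
  for A :: "('o, 'm, 'z) ab_category_scheme" (structure) +
  assumes zero_object: "\<exists>Z. is_zero_object A Z"
    and biproducts: "\<lbrakk>X \<in> Ob A; Y \<in> Ob A\<rbrakk> \<Longrightarrow> has_biproduct A X Y"
    and kernels: "f \<in> Ar A \<Longrightarrow> \<exists>k. is_kernel A f k"
    and cokernels: "f \<in> Ar A \<Longrightarrow> \<exists>c. is_cokernel A f c"
    and monic_normal: "monic A f \<Longrightarrow> \<exists>g. is_kernel A g f"
    and epic_conormal: "epic A f \<Longrightarrow> \<exists>g. is_cokernel A g f"

definition short_exact :: "('o, 'm, 'z) ab_category_scheme \<Rightarrow> 'm \<Rightarrow> 'm \<Rightarrow> bool" where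
  "short_exact A f g \<longleftrightarrow> is_kernel A g f \<and> is_cokernel A f g"


section \<open>Grothendieck categories\<close>

definition generating :: "('o, 'm, 'z) category_scheme \<Rightarrow> 'o set \<Rightarrow> bool" where
  "generating A \<G> \<longleftrightarrow> \<G> \<subseteq> Ob A \<and>
    (\<forall>X \<in> Ob A. \<forall>Y \<in> Ob A. \<forall>f \<in> Hom A X Y. \<forall>g \<in> Hom A X Y.
      f \<noteq> g \<longrightarrow> (\<exists>G \<in> \<G>. \<exists>e \<in> Hom A G X. f \<cdot>\<^bsub>A\<^esub> e \<noteq> g \<cdot>\<^bsub>A\<^esub> e))"

text \<open>The axiom AB5: small filtered colimits of short exact sequences are short exact.\<close>

definition exact_filtered_colimits ::
  "'u itself \<Rightarrow> ('o, 'm, 'z) ab_category_scheme \<Rightarrow> bool" where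
  "exact_filtered_colimits U A \<longleftrightarrow>
    (\<forall>(J :: ('u, 'u) category) Fo Fa Go Ga Ho Ha \<alpha> \<beta> L \<kappa> M \<mu> N \<nu> a b.
      small_filtered U J \<and>
      cat_functor J A Fo Fa \<and> cat_functor J A Go Ga \<and> cat_functor J A Ho Ha \<and>
      nat_trans J A Fo Fa Go Ga \<alpha> \<and> nat_trans J A Go Ga Ho Ha \<beta> \<and>
      (\<forall>i \<in> Ob J. short_exact A (\<alpha> i) (\<beta> i)) \<and>
      is_colimit J A Fo Fa L \<kappa> \<and> is_colimit J A Go Ga M \<mu> \<and> is_colimit J A Ho Ha N \<nu> \<and>
      a \<in> Hom A L M \<and> (\<forall>i \<in> Ob J. a \<cdot>\<^bsub>A\<^esub> \<kappa> i = \<mu> i \<cdot>\<^bsub>A\<^esub> \<alpha> i) \<and>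
      b \<in> Hom A M N \<and> (\<forall>i \<in> Ob J. b \<cdot>\<^bsub>A\<^esub> \<mu> i = \<nu> i \<cdot>\<^bsub>A\<^esub> \<beta> i) \<longrightarrow>
      short_exact A a b)"

locale grothendieck_category = abelian_category A
  for U :: "'u itself" and A :: "('o, 'm, 'z) ab_category_scheme" (structure) +
  assumes locally_small: "\<lbrakk>X \<in> Ob A; Y \<in> Ob A\<rbrakk> \<Longrightarrow> small U (Hom A X Y)"
    and small_coproducts: "\<And>(I :: 'u set) X. \<lbrakk>small U I; \<And>i. i \<in> I \<Longrightarrow> X i \<in> Ob A\<rbrakk> \<Longrightarrow>
      \<exists>S \<iota>. is_coproduct A I X S \<iota>"
    and AB5: "exact_filtered_colimits U A"
    and generator: "\<exists>G. generating A {G}"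

text \<open>
  The colimit in sets of the diagram of the sets \<open>Hom(X, F i)\<close> is the disjoint union
  of these sets modulo the equivalence relation generated by identifying \<open>(i, f)\<close> with
  \<open>(j, F(\<phi>) f)\<close> for every \<open>\<phi> : i \<rightarrow> j\<close>. For a cocone \<open>\<mu>\<close>
  from \<open>F\<close> to \<open>M\<close>, the canonical map to \<open>Hom(X, M)\<close> sends the class
  of \<open>(i, f)\<close> to \<open>\<mu> i f\<close>; this value is the unique element of the image of
  the class.
\<close>

definition hom_colim_gen ::
  "('i, 'j, 'y) category_scheme \<Rightarrow> ('o, 'm, 'z) category_scheme \<Rightarrow>
   ('i \<Rightarrow> 'o) \<Rightarrow> ('j \<Rightarrow> 'm) \<Rightarrow> 'o \<Rightarrow> (('i \<times> 'm) \<times> ('i \<times> 'm)) set" where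
  "hom_colim_gen J A Fo Fa X =
    {((i, f), (j, Fa \<phi> \<cdot>\<^bsub>A\<^esub> f)) | i j \<phi> f. \<phi> \<in> Hom J i j \<and> f \<in> Hom A X (Fo i)}"

definition hom_colim ::
  "('i, 'j, 'y) category_scheme \<Rightarrow> ('o, 'm, 'z) category_scheme \<Rightarrow>
   ('i \<Rightarrow> 'o) \<Rightarrow> ('j \<Rightarrow> 'm) \<Rightarrow> 'o \<Rightarrow> ('i \<times> 'm) set set" where
  "hom_colim J A Fo Fa X =
    (SIGMA i : Ob J. Hom A X (Fo i)) //
      (hom_colim_gen J A Fo Fa X \<union> (hom_colim_gen J A Fo Fa X)\<inverse>)\<^sup>*"

definition hom_preserves_colimit ::
  "('i, 'j, 'y) category_scheme \<Rightarrow> ('o, 'm, 'z) category_scheme \<Rightarrow>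
   ('i \<Rightarrow> 'o) \<Rightarrow> ('j \<Rightarrow> 'm) \<Rightarrow> 'o \<Rightarrow> ('i \<Rightarrow> 'm) \<Rightarrow> 'o \<Rightarrow> bool" where
  "hom_preserves_colimit J A Fo Fa M \<mu> X \<longleftrightarrow>
    bij_betw (\<lambda>c. the_elem ((\<lambda>(i, f). \<mu> i \<cdot>\<^bsub>A\<^esub> f) ` c)) (hom_colim J A Fo Fa X) (Hom A X M)"

definition finitely_generated ::
  "'u itself \<Rightarrow> ('o, 'm, 'z) category_scheme \<Rightarrow> 'o \<Rightarrow> bool" where
  "finitely_generated U A X \<longleftrightarrow> X \<in> Ob A \<and>
    (\<forall>(J :: ('u, 'u) category) Fo Fa M \<mu>.
      small_filtered U J \<and> cat_functor J A Fo Fa \<and> (\<forall>\<phi> \<in> Ar J. monic A (Fa \<phi>)) \<and>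
      is_colimit J A Fo Fa M \<mu> \<longrightarrow>
      hom_preserves_colimit J A Fo Fa M \<mu> X)"

definition noetherian :: "'u itself \<Rightarrow> ('o, 'm, 'z) category_scheme \<Rightarrow> 'o \<Rightarrow> bool" where
  "noetherian U A X \<longleftrightarrow> X \<in> Ob A \<and>
    (\<forall>i. monic A i \<and> Cod A i = X \<longrightarrow> finitely_generated U A (Dom A i))"

locale locally_noetherian_category = grothendieck_category U A
  for U :: "'u itself" and A :: "('o, 'm, 'z) ab_category_scheme" (structure) +
  assumes noetherian_generators:
    "\<exists>\<G>. small U \<G> \<and> generating A \<G> \<and> (\<forall>G \<in> \<G>. noetherian U A G)"


section \<open>Serre subcategories and closed objects\<close>

text \<open>
  A full subcategory is given by its class of objects. Nonemptiness is not required: for the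
  empty class there are no Serre isomorphisms and every object is closed.
\<close>

definition serre_subcategory :: "('o, 'm, 'z) ab_category_scheme \<Rightarrow> 'o set \<Rightarrow> bool" where
  "serre_subcategory A \<C> \<longleftrightarrow> \<C> \<subseteq> Ob A \<and>
    (\<forall>i. monic A i \<and> Cod A i \<in> \<C> \<longrightarrow> Dom A i \<in> \<C>) \<and>
    (\<forall>p. epic A p \<and> Dom A p \<in> \<C> \<longrightarrow> Cod A p \<in> \<C>) \<and>
    (\<forall>f g. short_exact A f g \<and> Dom A f \<in> \<C> \<and> Cod A g \<in> \<C> \<longrightarrow> Cod A f \<in> \<C>)"

definition serre_iso :: "('o, 'm, 'z) ab_category_scheme \<Rightarrow> 'o set \<Rightarrow> 'm \<Rightarrow> bool" where
  "serre_iso A \<C> u \<longleftrightarrow> u \<in> Ar A \<and>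
    (\<exists>k. is_kernel A u k \<and> Dom A k \<in> \<C>) \<and> (\<exists>c. is_cokernel A u c \<and> Cod A c \<in> \<C>)"

definition hom_map_iso :: "('o, 'm, 'z) ab_category_scheme \<Rightarrow> 'm \<Rightarrow> 'o \<Rightarrow> bool" where
  "hom_map_iso A u L \<longleftrightarrow>
    (\<lambda>f. f \<cdot>\<^bsub>A\<^esub> u) \<in> iso (hom_group A (Cod A u) L) (hom_group A (Dom A u) L)"

definition serre_closed :: "('o, 'm, 'z) ab_category_scheme \<Rightarrow> 'o set \<Rightarrow> 'o \<Rightarrow> bool" where
  "serre_closed A \<C> L \<longleftrightarrow> L \<in> Ob A \<and>
    (\<forall>X Y. \<forall>u \<in> Hom A X Y. serre_iso A \<C> u \<longrightarrow> hom_map_iso A u L)"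

end

theory Submission
  imports Defs "HOL-Algebra.FiniteProduct"
begin

text \<open>
  If \<open>f : G \<rightarrow> C\<close> is a morphism from a noetherian generator to an object of
  \<open>\<C>\<close>, its kernel \<open>K \<rightarrow> G\<close> is a \<open>\<C>\<close>-isomorphism between
  finitely generated objects, because its cokernel is a subobject of \<open>C\<close>. These
  \<open>\<C>\<close>-isomorphisms suffice. Applied to \<open>G \<rightarrow> C \<rightarrow> L\<close> they give
  \<open>Hom(C, L) = 0\<close> for all \<open>C\<close> in \<open>\<C>\<close>, hence injectivity of
  \<open>Hom(u, L)\<close>, and also that a morphism to \<open>L\<close> vanishing on the kernel of a morphism
  to an object of \<open>\<C>\<close> is zero.

  For surjectivity one may take \<open>u : X \<rightarrow> B\<close> monic; let \<open>g : X \<rightarrow> L\<close>. For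
  each \<open>e : G \<rightarrow> B\<close> the restriction of \<open>g\<close> to the pullback of \<open>X\<close> along
  \<open>e\<close> extends uniquely to \<open>h\<^sub>e : G \<rightarrow> L\<close>. The \<open>h\<^sub>e\<close> form a
  morphism \<open>H\<close> on the coproduct of all the \<open>G\<close>, and this coproduct maps onto \<open>B\<close>.
  A morphism from a finitely generated object to the coproduct lands in a finite subcoproduct, so
  on the kernel of the surjection a relation \<open>\<Sum> e\<^sub>i y\<^sub>i = 0\<close> can be restricted to the
  common kernel of the finitely many composites of \<open>e\<^sub>i y\<^sub>i\<close> with
  \<open>B \<rightarrow> B/X\<close>; there each \<open>e\<^sub>i y\<^sub>i\<close> lands in \<open>X\<close>, so
  \<open>\<Sum> h\<^sub>i y\<^sub>i = 0\<close>, hence everywhere. So \<open>H\<close> factors through \<open>B\<close>.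
\<close>

section \<open>Small sets\<close>

lemma small_lepoll: "S \<lesssim> T \<Longrightarrow> small U T \<Longrightarrow> small U S"
  unfolding small_def by (rule lesspoll_trans1)

lemma small_image: "small U S \<Longrightarrow> small U (f ` S)"
  by (rule small_lepoll[OF image_lepoll])

lemma small_inj_on:
  assumes "small (U :: 'u itself) S"
  obtains f :: "'a \<Rightarrow> 'u" where "inj_on f S"
  using assms lesspoll_imp_lepoll[of S "UNIV :: 'u set"]
  unfolding small_def lepoll_def by blast

context universe
begin

lemma infinite_UNIV: "infinite (UNIV :: 'u set)"
  using small_nat lesspoll_imp_lepoll unfolding small_def infinite_le_lepoll by blast

lemma small_finite: "finite S \<Longrightarrow> small U S"
  unfolding small_def by (rule finite_lesspoll_infinite[OF infinite_UNIV])

text \<open>An infinite type is equinumerous with its square. The code serves to tag members of a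
  family and to represent arrows of index categories.\<close>

lemma pairing: obtains pr :: "'u \<times> 'u \<Rightarrow> 'u" where "inj pr"
proof -
  have "(card_of ((UNIV :: 'u set) \<times> (UNIV :: 'u set)), card_of (UNIV :: 'u set)) \<in> ordIso"
    by (rule card_of_Times_same_infinite[OF infinite_UNIV])
  then obtain f :: "'u \<times> 'u \<Rightarrow> 'u" where "bij_betw f (UNIV \<times> UNIV) UNIV"
    using card_of_ordIso by blast
  then have "inj f" by (simp add: bij_betw_def)
  then show thesis by (rule that)
qed

text \<open>The axiom \<open>small_UN\<close> concerns only subsets of \<open>'u\<close> indexed by
  subsets of \<open>'u\<close>. Encoding the index set and the members in \<open>'u\<close> reduces
  the general case to it.\<close>

lemma small_Union:
  assumes I: "small U I" and F: "\<And>i. i \<in> I \<Longrightarrow> small U (F i)"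
  shows "small U (\<Union>i\<in>I. F i)"
proof -
  obtain enc :: "'a \<Rightarrow> 'u" where enc: "inj_on enc I" using small_inj_on[OF I] .
  obtain pr :: "'u \<times> 'u \<Rightarrow> 'u" where pr: "inj pr" using pairing .
  have "\<exists>g :: 'b \<Rightarrow> 'u. inj_on g (F i)" if "i \<in> I" for i
    using small_inj_on[OF F[OF that]] by metis
  then obtain g :: "'a \<Rightarrow> 'b \<Rightarrow> 'u" where g: "\<And>i. i \<in> I \<Longrightarrow> inj_on (g i) (F i)" by metis
  \<comment> \<open>The first component of each code records the index, so \<open>dec\<close> can
    pick the right inverse although the encodings of different members may overlap.\<close>
  define H where "H a = (\<lambda>x. pr (a, g (inv_into I enc a) x)) ` F (inv_into I enc a)" for a
  have small: "small U (\<Union>a\<in>enc ` I. H a)"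
  proof (rule small_UN)
    show "small U (enc ` I)" by (rule small_image[OF I])
    show "small U (H a)" if "a \<in> enc ` I" for a
      unfolding H_def by (intro small_image F inv_into_into that)
  qed
  define dec where "dec u = (let (a, b) = inv_into UNIV pr u; i = inv_into I enc a in inv_into (F i) (g i) b)" for u
  have "(\<Union>i\<in>I. F i) \<subseteq> dec ` (\<Union>a\<in>enc ` I. H a)"
  proof
    fix x assume "x \<in> (\<Union>i\<in>I. F i)"
    then obtain i where i: "i \<in> I" "x \<in> F i" by blast
    then have "pr (enc i, g i x) \<in> H (enc i)" by (auto simp: H_def enc)
    moreover have "dec (pr (enc i, g i x)) = x" using i g by (simp add: dec_def enc pr)
    ultimately show "x \<in> dec ` (\<Union>a\<in>enc ` I. H a)" using i by (metis UN_I image_eqI)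
  qed
  then show ?thesis by (rule small_lepoll[OF subset_image_lepoll small])
qed

lemma small_Times:
  assumes "small U S" "small U T" shows "small U (S \<times> T)"
proof -
  have "S \<times> T = (\<Union>s\<in>S. Pair s ` T)" by auto
  moreover have "small U (\<Union>s\<in>S. Pair s ` T)" by (intro small_Union small_image assms)
  ultimately show ?thesis by simp
qed

lemma small_finite_subsets:
  fixes I :: "'u set"
  assumes "small U I" shows "small U {F. F \<subseteq> I \<and> finite F}"
proof -
  have "{F. F \<subseteq> I \<and> finite F} \<lesssim> Pow I" by (rule subset_imp_lepoll) auto
  then show ?thesis using small_Pow[OF assms] by (rule small_lepoll)
qed

end


section \<open>Categories\<close>

context category
begin

lemma Dom_Ob: "f \<in> Hom A X Y \<Longrightarrow> X \<in> Ob A"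
  and Cod_Ob: "f \<in> Hom A X Y \<Longrightarrow> Y \<in> Ob A"
  using Dom_in_Ob Cod_in_Ob by (auto simp: Hom_def)

lemma monicD:
  "\<lbrakk>monic A f; f \<in> Hom A X Y; g \<in> Hom A W X; h \<in> Hom A W X; f \<cdot> g = f \<cdot> h\<rbrakk> \<Longrightarrow> g = h"
  using Dom_Ob[of g W X] by (auto simp: monic_def Hom_def)

lemma epicD:
  "\<lbrakk>epic A f; f \<in> Hom A X Y; g \<in> Hom A Y Z; h \<in> Hom A Y Z; g \<cdot> f = h \<cdot> f\<rbrakk> \<Longrightarrow> g = h"
  using Cod_Ob[of g Y Z] by (auto simp: epic_def Hom_def)

lemma monic_Ide: "X \<in> Ob A \<Longrightarrow> monic A (Ide A X)"
  using Ide_in_Hom[of X] Ide_Comp[of _ _ X] by (auto simp: monic_def Hom_def)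

lemma monic_split:
  assumes f: "f \<in> Hom A X Y" and r: "r \<in> Hom A Y X" and rf: "r \<cdot> f = Ide A X"
  shows "monic A f"
  unfolding monic_def
proof (intro conjI ballI impI)
  show "f \<in> Ar A" using f by (simp add: Hom_def)
  fix W g h assume "W \<in> Ob A" "g \<in> Hom A W (Dom A f)" "h \<in> Hom A W (Dom A f)"
    and eq: "f \<cdot> g = f \<cdot> h"
  then have gh: "g \<in> Hom A W X" "h \<in> Hom A W X" using f by (auto simp: Hom_def)
  have "Ide A X \<cdot> g = Ide A X \<cdot> h"
    unfolding rf[symmetric] using Comp_assoc[OF gh(1) f r] Comp_assoc[OF gh(2) f r] eq by simp
  then show "g = h" using gh Ide_Comp by simp
qed

lemma epic_Comp:
  assumes f: "f \<in> Hom A X Y" "epic A f" and g: "g \<in> Hom A Y Z" "epic A g"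
  shows "epic A (g \<cdot> f)"
  unfolding epic_def
proof (intro conjI ballI impI)
  note gf = Comp_in_Hom[OF f(1) g(1)]
  show "g \<cdot> f \<in> Ar A" using gf by (simp add: Hom_def)
  fix W a b assume "W \<in> Ob A" "a \<in> Hom A (Cod A (g \<cdot> f)) W" "b \<in> Hom A (Cod A (g \<cdot> f)) W"
    and eq: "a \<cdot> (g \<cdot> f) = b \<cdot> (g \<cdot> f)"
  then have a: "a \<in> Hom A Z W" and b: "b \<in> Hom A Z W" using gf by (auto simp: Hom_def)
  have "(a \<cdot> g) \<cdot> f = (b \<cdot> g) \<cdot> f" 
    using eq Comp_assoc[OF f(1) g(1) a] Comp_assoc[OF f(1) g(1) b] by simp
  then have "a \<cdot> g = b \<cdot> g"
    using epicD[OF f(2,1) Comp_in_Hom[OF g(1) a] Comp_in_Hom[OF g(1) b]] by simp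
  then show "a = b" using epicD[OF g(2,1) a b] by simp
qed

lemma generating_eqI:
  assumes "generating A \<G>" "f \<in> Hom A X Y" "g \<in> Hom A X Y"
    and "\<And>G e. G \<in> \<G> \<Longrightarrow> e \<in> Hom A G X \<Longrightarrow> f \<cdot> e = g \<cdot> e"
  shows "f = g"
proof (rule ccontr)
  assume "f \<noteq> g"
  moreover have "X \<in> Ob A" "Y \<in> Ob A" using assms(2) Dom_Ob Cod_Ob by auto
  ultimately obtain G e where "G \<in> \<G>" "e \<in> Hom A G X" "f \<cdot> e \<noteq> g \<cdot> e"
    using assms(1-3) unfolding generating_def by blast
  then show False using assms(4) by simp
qed

section \<open>Universal property of coproducts\<close>

lemma coproduct_injection:
  "is_coproduct A I X S \<iota> \<Longrightarrow> i \<in> I \<Longrightarrow> \<iota> i \<in> Hom A (X i) S"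
  by (simp add: is_coproduct_def)

lemma coproduct_ex1:
  assumes S: "is_coproduct A I X S \<iota>" and N: "N \<in> Ob A"
    and \<nu>: "\<And>i. i \<in> I \<Longrightarrow> \<nu> i \<in> Hom A (X i) N"
  shows "\<exists>!m. m \<in> Hom A S N \<and> (\<forall>i \<in> I. m \<cdot> \<iota> i = \<nu> i)"
  using S[unfolded is_coproduct_def, THEN conjunct2, THEN conjunct2, THEN bspec, OF N,
      THEN spec, of \<nu>] \<nu> by blast

lemma coproduct_lift:
  assumes "is_coproduct A I X S \<iota>" "N \<in> Ob A" "\<And>i. i \<in> I \<Longrightarrow> \<nu> i \<in> Hom A (X i) N"
  obtains m where "m \<in> Hom A S N" "\<And>i. i \<in> I \<Longrightarrow> m \<cdot> \<iota> i = \<nu> i"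
  using ex1_implies_ex[OF coproduct_ex1[OF assms]] that by auto

lemma coproduct_eqI:
  assumes S: "is_coproduct A I X S \<iota>" and f: "f \<in> Hom A S N" and g: "g \<in> Hom A S N"
    and eq: "\<And>i. i \<in> I \<Longrightarrow> f \<cdot> \<iota> i = g \<cdot> \<iota> i"
  shows "f = g"
proof -
  have "\<exists>!m. m \<in> Hom A S N \<and> (\<forall>i \<in> I. m \<cdot> \<iota> i = f \<cdot> \<iota> i)"
    by (rule coproduct_ex1[OF S Cod_Ob[OF f]], rule Comp_in_Hom[OF coproduct_injection[OF S] f])
  then show ?thesis using f g eq by (metis (no_types, lifting))
qed

text \<open>Surjectivity of the canonical map provides a class that is sent to \<open>x\<close>; a
  representative of this class is the factorization.\<close>

lemma hom_preserves_colimit_factor: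
  fixes J :: "('i, 'j, 'y) category_scheme"
  assumes F: "cat_functor J A Fo Fa" and M: "is_cocone J A Fo Fa M \<mu>"
    and pres: "hom_preserves_colimit J A Fo Fa M \<mu> X" and x: "x \<in> Hom A X M"
  obtains i f where "i \<in> Ob J" "f \<in> Hom A X (Fo i)" "x = \<mu> i \<cdot> f"
proof -
  interpret F: cat_functor J A Fo Fa by (rule F)
  let ?R = "hom_colim_gen J A Fo Fa X"
  let ?\<mu> = "\<lambda>(i, f). \<mu> i \<cdot> f"
  have gen: "?\<mu> p = ?\<mu> q" if "(p, q) \<in> ?R" for p q
  proof -
    obtain i j \<phi> f where pq: "p = (i, f)" "q = (j, Fa \<phi> \<cdot> f)" and \<phi>: "\<phi> \<in> Hom J i j"
      and f: "f \<in> Hom A X (Fo i)" using \<open>(p, q) \<in> ?R\<close> by (auto simp: hom_colim_gen_def)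
    have "\<mu> j \<cdot> Fa \<phi> = \<mu> i" and "\<mu> j \<in> Hom A (Fo j) M"
      using M \<phi> F.J.Cod_Ob[OF \<phi>] by (auto simp: is_cocone_def)
    then show ?thesis using Comp_assoc[OF f F.Fa_in_Hom[OF \<phi>], of "\<mu> j" M] by (simp add: pq)
  qed
  have rel: "?\<mu> p = ?\<mu> q" if "(p, q) \<in> (?R \<union> ?R\<inverse>)\<^sup>*" for p q
    using that by (induction rule: rtrancl_induct) (auto dest: gen)
  obtain c where c: "c \<in> hom_colim J A Fo Fa X" and xc: "x = the_elem (?\<mu> ` c)"
    using pres x unfolding hom_preserves_colimit_def bij_betw_def by blast
  obtain p where p: "p \<in> (SIGMA i : Ob J. Hom A X (Fo i))" and cp: "c = (?R \<union> ?R\<inverse>)\<^sup>* `` {p}"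
    using c by (auto simp: hom_colim_def elim: quotientE)
  \<comment> \<open>All representatives have the same value, so \<open>the_elem\<close> acts on a
    singleton.\<close>
  have "?\<mu> ` c = {?\<mu> p}" 
  proof
    show "?\<mu> ` c \<subseteq> {?\<mu> p}" unfolding cp using rel by fastforce
    show "{?\<mu> p} \<subseteq> ?\<mu> ` c" unfolding cp by blast
  qed
  then have "x = ?\<mu> p" using xc by simp
  then show thesis using that p by auto
qed

end


section \<open>Preadditive categories\<close>

lemma hom_group_simps [simp]:
  "carrier (hom_group A X Y) = Hom A X Y"
  "mult (hom_group A X Y) = Add A"
  "one (hom_group A X Y) = Zero A X Y"
  by (simp_all add: hom_group_def)

context preadditive_category
begin

lemma Zero_in_Hom: "\<lbrakk>X \<in> Ob A; Y \<in> Ob A\<rbrakk> \<Longrightarrow> Zero A X Y \<in> Hom A X Y"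
  using monoid.one_closed[OF comm_monoid.axioms(1)[OF comm_group.axioms(1)[OF comm_group_Hom]]]
  by fastforce

lemma Add_Zero: "f \<in> Hom A X Y \<Longrightarrow> Add A (Zero A X Y) f = f"
  using monoid.l_one[OF comm_monoid.axioms(1)[OF comm_group.axioms(1)[OF comm_group_Hom]],
      of X Y f] Dom_Ob Cod_Ob by simp

lemma Zero_eqI:
  assumes "f \<in> Hom A X Y" "g \<in> Hom A X Y" "Add A f g = g" shows "f = Zero A X Y"
proof -
  interpret comm_group "hom_group A X Y"
    by (rule comm_group_Hom[OF Dom_Ob[OF assms(1)] Cod_Ob[OF assms(1)]])
  show ?thesis using l_cancel_one[of g f] r_cancel_one[of g f] assms by simp
qed

text \<open>Subtraction expressed through \<open>Add\<close> alone, which keeps inverses in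
  \<open>hom_group\<close> out of later arguments.\<close>

lemma difference:
  assumes "f \<in> Hom A X Y" "g \<in> Hom A X Y"
  obtains d where "d \<in> Hom A X Y" "Add A d g = f"
proof -
  interpret comm_group "hom_group A X Y"
    by (rule comm_group_Hom[OF Dom_Ob[OF assms(1)] Cod_Ob[OF assms(1)]])
  have "mult (hom_group A X Y) (mult (hom_group A X Y) f (inv\<^bsub>hom_group A X Y\<^esub> g)) g = f"
    using assms m_assoc[of f _ g] inv_closed[of g] l_inv[of g] r_one[of f] by simp
  moreover have "mult (hom_group A X Y) f (inv\<^bsub>hom_group A X Y\<^esub> g) \<in> carrier (hom_group A X Y)"
    using assms inv_closed[of g] m_closed[of f] by simp
  ultimately show thesis using that by simp
qed

text \<open>By additivity the composite equals its own double, and in a group only the neutral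
  element does.\<close>

lemma Comp_Zero:
  assumes f: "f \<in> Hom A X Y" and W: "W \<in> Ob A"
  shows "f \<cdot> Zero A W X = Zero A W Y"
proof (rule Zero_eqI)
  note Z = Zero_in_Hom[OF W Dom_Ob[OF f]]
  show "f \<cdot> Zero A W X \<in> Hom A W Y" by (rule Comp_in_Hom[OF Z f])
  then show "f \<cdot> Zero A W X \<in> Hom A W Y" .
  show "Add A (f \<cdot> Zero A W X) (f \<cdot> Zero A W X) = f \<cdot> Zero A W X"
    using Comp_Add_right[OF Z Z f] Add_Zero[OF Z] by simp
qed

lemma Zero_Comp:
  assumes f: "f \<in> Hom A X Y" and Z: "Z \<in> Ob A"
  shows "Zero A Y Z \<cdot> f = Zero A X Z"
proof (rule Zero_eqI)
  note Z0 = Zero_in_Hom[OF Cod_Ob[OF f] Z]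
  show "Zero A Y Z \<cdot> f \<in> Hom A X Z" by (rule Comp_in_Hom[OF f Z0])
  then show "Zero A Y Z \<cdot> f \<in> Hom A X Z" .
  show "Add A (Zero A Y Z \<cdot> f) (Zero A Y Z \<cdot> f) = Zero A Y Z \<cdot> f"
    using Comp_Add_left[OF f Z0 Z0] Add_Zero[OF Z0] by simp
qed

lemma monicI:
  assumes f: "f \<in> Hom A X Y"
    and 0: "\<And>W h. h \<in> Hom A W X \<Longrightarrow> f \<cdot> h = Zero A W Y \<Longrightarrow> h = Zero A W X"
  shows "monic A f"
  unfolding monic_def
proof (intro conjI ballI impI)
  show "f \<in> Ar A" using f by (simp add: Hom_def)
  fix W g h assume "W \<in> Ob A" "g \<in> Hom A W (Dom A f)" "h \<in> Hom A W (Dom A f)"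
    and eq: "f \<cdot> g = f \<cdot> h"
  then have g: "g \<in> Hom A W X" and h: "h \<in> Hom A W X" using f by (auto simp: Hom_def)
  obtain d where d: "d \<in> Hom A W X" "Add A d h = g" using difference[OF g h] .
  have "Add A (f \<cdot> d) (f \<cdot> h) = f \<cdot> h" using Comp_Add_right[OF d(1) h f] d(2) eq by simp
  then have "d = Zero A W X"
    using 0[OF d(1)] Zero_eqI[OF Comp_in_Hom[OF d(1) f] Comp_in_Hom[OF h f]] by simp
  then show "g = h" using d Add_Zero[OF h] by simp
qed

text \<open>The product \<open>finprod\<close> is a finite sum here because the multiplication of
  \<open>hom_group\<close> is \<open>Add\<close>.\<close>

abbreviation hom_sum :: "'o \<Rightarrow> 'o \<Rightarrow> ('i \<Rightarrow> 'm) \<Rightarrow> 'i set \<Rightarrow> 'm" where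
  "hom_sum X Y f F \<equiv> finprod (hom_group A X Y) f F"

lemma hom_sum_empty: "X \<in> Ob A \<Longrightarrow> Y \<in> Ob A \<Longrightarrow> hom_sum X Y f {} = Zero A X Y"
  using comm_monoid.finprod_empty[OF comm_group.axioms(1)[OF comm_group_Hom]] by fastforce

lemma hom_sum_insert:
  assumes "X \<in> Ob A" "Y \<in> Ob A" "finite F" "i \<notin> F" "\<And>j. j \<in> insert i F \<Longrightarrow> f j \<in> Hom A X Y"
  shows "hom_sum X Y f (insert i F) = Add A (f i) (hom_sum X Y f F)"
  using comm_monoid.finprod_insert[OF comm_group.axioms(1)[OF comm_group_Hom[OF assms(1,2)]]
      assms(3,4), of f] assms(5) by (auto simp: Pi_def)

lemma hom_sum_in_Hom:
  assumes "X \<in> Ob A" "Y \<in> Ob A" "\<And>j. j \<in> F \<Longrightarrow> f j \<in> Hom A X Y"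
  shows "hom_sum X Y f F \<in> Hom A X Y"
  using comm_monoid.finprod_closed[OF comm_group.axioms(1)[OF comm_group_Hom[OF assms(1,2)]],
      of f F] assms(3) by (auto simp: Pi_def)

lemma hom_sum_cong:
  assumes "X \<in> Ob A" "Y \<in> Ob A" "\<And>j. j \<in> F \<Longrightarrow> g j \<in> Hom A X Y" "\<And>j. j \<in> F \<Longrightarrow> f j = g j"
  shows "hom_sum X Y f F = hom_sum X Y g F"
  using comm_monoid.finprod_cong'[OF comm_group.axioms(1)[OF comm_group_Hom[OF assms(1,2)]],
      of F F g f] assms(3,4) by (auto simp: Pi_def)

lemma Comp_hom_sum:
  assumes h: "h \<in> Hom A Y Z" and X: "X \<in> Ob A"
    and "finite F" "\<And>i. i \<in> F \<Longrightarrow> f i \<in> Hom A X Y"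
  shows "h \<cdot> hom_sum X Y f F = hom_sum X Z (\<lambda>i. h \<cdot> f i) F"
  using assms(3,4)
proof (induction F rule: finite_induct)
  case empty
  then show ?case using Comp_Zero[OF h X] X Dom_Ob[OF h] Cod_Ob[OF h] by (simp add: hom_sum_empty)
next
  case (insert i F)
  have "h \<cdot> hom_sum X Y f (insert i F) = h \<cdot> Add A (f i) (hom_sum X Y f F)"
    using insert X Dom_Ob[OF h] by (subst hom_sum_insert) auto
  also have "\<dots> = Add A (h \<cdot> f i) (h \<cdot> hom_sum X Y f F)"
    using insert.prems X Dom_Ob[OF h] h by (intro Comp_Add_right[OF _ _ h]) (auto intro!: hom_sum_in_Hom)
  also have "\<dots> = hom_sum X Z (\<lambda>i. h \<cdot> f i) (insert i F)"
    using insert X Cod_Ob[OF h] Comp_in_Hom[OF _ h] by (subst hom_sum_insert) auto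
  finally show ?case .
qed

lemma hom_sum_Comp:
  assumes h: "h \<in> Hom A W X" and Y: "Y \<in> Ob A"
    and "finite F" "\<And>i. i \<in> F \<Longrightarrow> f i \<in> Hom A X Y"
  shows "hom_sum X Y f F \<cdot> h = hom_sum W Y (\<lambda>i. f i \<cdot> h) F"
  using assms(3,4)
proof (induction F rule: finite_induct)
  case empty
  then show ?case using Zero_Comp[OF h Y] Y Dom_Ob[OF h] Cod_Ob[OF h] by (simp add: hom_sum_empty)
next
  case (insert i F)
  have "hom_sum X Y f (insert i F) \<cdot> h = Add A (f i) (hom_sum X Y f F) \<cdot> h"
    using insert Y Cod_Ob[OF h] by (subst hom_sum_insert) auto
  also have "\<dots> = Add A (f i \<cdot> h) (hom_sum X Y f F \<cdot> h)"
    using insert.prems Y Cod_Ob[OF h] h by (intro Comp_Add_left[OF h]) (auto intro!: hom_sum_in_Hom)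
  also have "\<dots> = hom_sum W Y (\<lambda>i. f i \<cdot> h) (insert i F)"
    using insert Y Dom_Ob[OF h] Comp_in_Hom[OF h] by (subst hom_sum_insert) auto
  finally show ?case .
qed

text \<open>A finite coproduct in a preadditive category is a biproduct: its injections admit
  projections, and the resolution of the identity can be checked on every injection.\<close>

lemma finite_coproduct_decomposition:
  assumes S: "is_coproduct A F X S \<iota>" and F: "finite F"
  obtains \<pi> where "\<And>i. i \<in> F \<Longrightarrow> \<pi> i \<in> Hom A S (X i)"
    and "hom_sum S S (\<lambda>i. \<iota> i \<cdot> \<pi> i) F = Ide A S"
proof -
  note \<iota> = coproduct_injection[OF S]
  have SO: "S \<in> Ob A" using S by (simp add: is_coproduct_def)
  \<comment> \<open>Row \<open>i\<close> of the identity matrix; it induces the projection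
    \<open>\<pi> i\<close> on the coproduct.\<close>
  define \<delta> where "\<delta> i j = (if i = j then Ide A (X i) else Zero A (X j) (X i))" for i j
  have \<delta>: "\<delta> i j \<in> Hom A (X j) (X i)" if "i \<in> F" "j \<in> F" for i j
    using that Dom_Ob[OF \<iota>] Ide_in_Hom Zero_in_Hom by (auto simp: \<delta>_def)
  have "\<exists>p. p \<in> Hom A S (X i) \<and> (\<forall>j\<in>F. p \<cdot> \<iota> j = \<delta> i j)" if i: "i \<in> F" for i
    using coproduct_lift[OF S Dom_Ob[OF \<iota>[OF i]], of "\<delta> i"] \<delta>[OF i] by metis
  then obtain \<pi> where \<pi>: "\<And>i. i \<in> F \<Longrightarrow> \<pi> i \<in> Hom A S (X i)"
    and \<pi>\<iota>: "\<And>i j. i \<in> F \<Longrightarrow> j \<in> F \<Longrightarrow> \<pi> i \<cdot> \<iota> j = \<delta> i j" by metis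
  note \<iota>\<pi> = Comp_in_Hom[OF \<pi> \<iota>]
  have "hom_sum S S (\<lambda>i. \<iota> i \<cdot> \<pi> i) F = Ide A S"
  proof (rule coproduct_eqI[OF S])
    show "hom_sum S S (\<lambda>i. \<iota> i \<cdot> \<pi> i) F \<in> Hom A S S" by (rule hom_sum_in_Hom[OF SO SO \<iota>\<pi>])
    show "Ide A S \<in> Hom A S S" by (rule Ide_in_Hom[OF SO])
    fix j assume j: "j \<in> F"
    have XO: "X j \<in> Ob A" by (rule Dom_Ob[OF \<iota>[OF j]])
    have "hom_sum S S (\<lambda>i. \<iota> i \<cdot> \<pi> i) F \<cdot> \<iota> j = hom_sum (X j) S (\<lambda>i. (\<iota> i \<cdot> \<pi> i) \<cdot> \<iota> j) F"
      by (rule hom_sum_Comp[OF \<iota>[OF j] SO F \<iota>\<pi>])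
    also have "\<dots> = hom_sum (X j) S (\<lambda>i. if j = i then \<iota> i else Zero A (X j) S) F"
    proof (rule hom_sum_cong[OF XO SO])
      fix i assume i: "i \<in> F"
      show "(if j = i then \<iota> i else Zero A (X j) S) \<in> Hom A (X j) S"
        using \<iota>[OF j] Zero_in_Hom[OF XO SO] by auto
      have "(\<iota> i \<cdot> \<pi> i) \<cdot> \<iota> j = \<iota> i \<cdot> \<delta> i j"
        using Comp_assoc[OF \<iota>[OF j] \<pi>[OF i] \<iota>[OF i]] \<pi>\<iota>[OF i j] by simp
      then show "(\<iota> i \<cdot> \<pi> i) \<cdot> \<iota> j = (if j = i then \<iota> i else Zero A (X j) S)"
        using Comp_Ide[OF \<iota>[OF i]] Comp_Zero[OF \<iota>[OF i] XO] by (auto simp: \<delta>_def)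
    qed
    \<comment> \<open>The value is used only when \<open>j = i\<close>, so it can be written with
      \<open>j\<close>, the form that \<open>finprod_singleton\<close> expects.\<close>
    also have "\<dots> = hom_sum (X j) S (\<lambda>i. if j = i then \<iota> j else Zero A (X j) S) F"
      using \<iota>[OF j] Zero_in_Hom[OF XO SO] by (intro hom_sum_cong[OF XO SO]) auto
    also have "\<dots> = \<iota> j"
      using comm_monoid.finprod_singleton[OF comm_group.axioms(1)[OF comm_group_Hom[OF XO SO]]
          j F, of "\<lambda>_. \<iota> j"] \<iota>[OF j] by (simp cong: if_cong)
    also have "\<dots> = Ide A S \<cdot> \<iota> j" using Ide_Comp[OF \<iota>[OF j]] by simp
    finally show "hom_sum S S (\<lambda>i. \<iota> i \<cdot> \<pi> i) F \<cdot> \<iota> j = Ide A S \<cdot> \<iota> j" .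
  qed
  then show thesis using that \<pi> by blast
qed

text \<open>The inclusion of a subcoproduct splits: a retraction is the injection on summands in
  \<open>I\<close> and zero on the others.\<close>

lemma monic_subcoproduct:
  assumes S: "is_coproduct A I X S \<iota>" and T: "is_coproduct A K X T \<kappa>" and IK: "I \<subseteq> K"
    and t: "t \<in> Hom A S T" "\<And>i. i \<in> I \<Longrightarrow> t \<cdot> \<iota> i = \<kappa> i"
  shows "monic A t"
proof -
  have SO: "S \<in> Ob A" by (rule Dom_Ob[OF t(1)])
  define \<rho> where "\<rho> i = (if i \<in> I then \<iota> i else Zero A (X i) S)" for i
  have \<rho>: "\<rho> i \<in> Hom A (X i) S" if "i \<in> K" for i
    using that coproduct_injection[OF S] Zero_in_Hom[OF Dom_Ob[OF coproduct_injection[OF T]] SO]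
    by (auto simp: \<rho>_def)
  obtain r where r: "r \<in> Hom A T S" "\<And>i. i \<in> K \<Longrightarrow> r \<cdot> \<kappa> i = \<rho> i"
    using coproduct_lift[OF T SO \<rho>] by blast
  have "r \<cdot> t = Ide A S"
  proof (rule coproduct_eqI[OF S Comp_in_Hom[OF t(1) r(1)] Ide_in_Hom[OF SO]])
    fix i assume i: "i \<in> I"
    have "(r \<cdot> t) \<cdot> \<iota> i = r \<cdot> \<kappa> i"
      using Comp_assoc[OF coproduct_injection[OF S i] t(1) r(1)] t(2)[OF i] by simp
    also have "\<dots> = \<iota> i" using r(2) i IK by (auto simp: \<rho>_def)
    finally show "(r \<cdot> t) \<cdot> \<iota> i = Ide A S \<cdot> \<iota> i" using Ide_Comp coproduct_injection[OF S i] by metis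
  qed
  then show ?thesis by (rule monic_split[OF t(1) r(1)])
qed

section \<open>Kernels and cokernels\<close>

lemma kernel_in_Hom: "is_kernel A f k \<Longrightarrow> f \<in> Hom A X Y \<Longrightarrow> k \<in> Hom A (Dom A k) X"
  by (auto simp: is_kernel_def Hom_def)

lemma kernel_Comp: "is_kernel A f k \<Longrightarrow> f \<in> Hom A X Y \<Longrightarrow> f \<cdot> k = Zero A (Dom A k) Y"
  by (auto simp: is_kernel_def Hom_def)

lemma kernel_ex1:
  assumes "is_kernel A f k" "f \<in> Hom A X Y" "h \<in> Hom A W X" "f \<cdot> h = Zero A W Y"
  shows "\<exists>!g. g \<in> Hom A W (Dom A k) \<and> k \<cdot> g = h"
proof -
  have "Dom A f = X" "Cod A f = Y" using assms(2) by (auto simp: Hom_def)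
  then show ?thesis using assms Dom_Ob[OF assms(3)] unfolding is_kernel_def by blast
qed

lemma kernel_lift:
  assumes "is_kernel A f k" "f \<in> Hom A X Y" "h \<in> Hom A W X" "f \<cdot> h = Zero A W Y"
  obtains g where "g \<in> Hom A W (Dom A k)" "k \<cdot> g = h"
  using ex1_implies_ex[OF kernel_ex1[OF assms]] that by blast

lemma kernel_monic:
  assumes k: "is_kernel A f k" and f: "f \<in> Hom A X Y"
  shows "monic A k"
proof (rule monicI[OF kernel_in_Hom[OF assms]])
  note kH = kernel_in_Hom[OF assms]
  fix W h assume h: "h \<in> Hom A W (Dom A k)" and kh: "k \<cdot> h = Zero A W X"
  note Z = Zero_in_Hom[OF Dom_Ob[OF h] Dom_Ob[OF kH]]
  have "\<exists>!g. g \<in> Hom A W (Dom A k) \<and> k \<cdot> g = Zero A W X"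
    using Comp_Zero[OF f Dom_Ob[OF h]]
    by (rule kernel_ex1[OF k f Zero_in_Hom[OF Dom_Ob[OF h] Dom_Ob[OF f]]])
  then show "h = Zero A W (Dom A k)"
    using h kh Z Comp_Zero[OF kH Dom_Ob[OF h]] by (metis (no_types, lifting))
qed

lemma cokernel_in_Hom: "is_cokernel A f c \<Longrightarrow> f \<in> Hom A X Y \<Longrightarrow> c \<in> Hom A Y (Cod A c)"
  by (auto simp: is_cokernel_def Hom_def)

lemma cokernel_Comp: "is_cokernel A f c \<Longrightarrow> f \<in> Hom A X Y \<Longrightarrow> c \<cdot> f = Zero A X (Cod A c)"
  by (auto simp: is_cokernel_def Hom_def)

lemma cokernel_ex1:
  assumes "is_cokernel A f c" "f \<in> Hom A X Y" "h \<in> Hom A Y Z" "h \<cdot> f = Zero A X Z"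
  shows "\<exists>!g. g \<in> Hom A (Cod A c) Z \<and> g \<cdot> c = h"
proof -
  have "Dom A f = X" "Cod A f = Y" using assms(2) by (auto simp: Hom_def)
  then show ?thesis using assms Cod_Ob[OF assms(3)] unfolding is_cokernel_def by blast
qed

lemma cokernel_factor:
  assumes "is_cokernel A f c" "f \<in> Hom A X Y" "h \<in> Hom A Y Z" "h \<cdot> f = Zero A X Z"
  obtains g where "g \<in> Hom A (Cod A c) Z" "g \<cdot> c = h"
  using ex1_implies_ex[OF cokernel_ex1[OF assms]] that by blast

lemma cokernel_epic:
  assumes c: "is_cokernel A f c" and f: "f \<in> Hom A X Y"
  shows "epic A c"
  unfolding epic_def
proof (intro conjI ballI impI)
  note cH = cokernel_in_Hom[OF assms]
  show "c \<in> Ar A" using cH by (simp add: Hom_def)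
  fix Z g h assume g: "g \<in> Hom A (Cod A c) Z" and h: "h \<in> Hom A (Cod A c) Z"
    and eq: "g \<cdot> c = h \<cdot> c"
  have "(g \<cdot> c) \<cdot> f = Zero A X Z"
    using Comp_assoc[OF f cH g] cokernel_Comp[OF c f] Comp_Zero[OF g Dom_Ob[OF f]] by simp
  from cokernel_ex1[OF c f Comp_in_Hom[OF cH g] this] show "g = h"
    using g h eq by (metis (no_types, lifting))
qed

lemma epic_Zero:
  assumes p: "p \<in> Hom A X Y" "epic A p" and w: "w \<in> Hom A Y Z" and wp: "w \<cdot> p = Zero A X Z"
  shows "w = Zero A Y Z"
  using epicD[OF p(2,1) w Zero_in_Hom[OF Dom_Ob[OF w] Cod_Ob[OF w]]] wp
    Zero_Comp[OF p(1) Cod_Ob[OF w]] by simp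

lemma monic_Zero:
  assumes m: "m \<in> Hom A X Y" "monic A m" and w: "w \<in> Hom A W X" and mw: "m \<cdot> w = Zero A W Y"
  shows "w = Zero A W X"
  using monicD[OF m(2,1) w Zero_in_Hom[OF Dom_Ob[OF w] Cod_Ob[OF w]]] mw
    Comp_Zero[OF m(1) Dom_Ob[OF w]] by simp

end


section \<open>Abelian categories\<close>

context abelian_category
begin

lemma kernel_exists:
  assumes "f \<in> Hom A X Y" obtains k where "is_kernel A f k"
  using assms kernels by (auto simp: Hom_def)

lemma cokernel_exists:
  assumes "f \<in> Hom A X Y" obtains c where "is_cokernel A f c"
  using assms cokernels by (auto simp: Hom_def)

text \<open>By conormality \<open>p\<close> is the cokernel of some \<open>g\<close>. Since
  \<open>g\<close> factors through \<open>k\<close>, every morphism that kills \<open>k\<close>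
  kills \<open>g\<close> and so factors uniquely through \<open>p\<close>.\<close>

lemma epic_is_cokernel_of_kernel:
  assumes p: "p \<in> Hom A X Y" "epic A p" and k: "is_kernel A p k"
  shows "is_cokernel A k p"
proof -
  note kH = kernel_in_Hom[OF k p(1)]
  obtain g where g: "is_cokernel A g p" using epic_conormal[OF p(2)] by blast
  then have gX: "g \<in> Hom A (Dom A g) X" using p(1) by (auto simp: is_cokernel_def Hom_def)
  have Cp: "Cod A p = Y" using p(1) by (simp add: Hom_def)
  obtain l where l: "l \<in> Hom A (Dom A g) (Dom A k)" "k \<cdot> l = g"
    using kernel_lift[OF k p(1) gX] cokernel_Comp[OF g gX] Cp by metis
  show ?thesis
    unfolding is_cokernel_def
  proof (intro conjI ballI impI)
    show "k \<in> Ar A" "p \<in> Ar A" "Dom A p = Cod A k" using kH p(1) by (auto simp: Hom_def)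
    show "p \<cdot> k = Zero A (Dom A k) (Cod A p)" using kernel_Comp[OF k p(1)] Cp by simp
    fix Z h assume Z: "Z \<in> Ob A" and "h \<in> Hom A (Cod A k) Z" and hk: "h \<cdot> k = Zero A (Dom A k) Z"
    then have h: "h \<in> Hom A X Z" using kH by (auto simp: Hom_def)
    have "h \<cdot> g = Zero A (Dom A g) Z"
      using Comp_assoc[OF l(1) kH h] hk l(2) Zero_Comp[OF l(1) Z] by simp
    then show "\<exists>!m. m \<in> Hom A (Cod A p) Z \<and> m \<cdot> p = h" by (rule cokernel_ex1[OF g gX h])
  qed
qed

text \<open>The factor \<open>m\<close> comes from the universal property of \<open>p\<close>.
  Monicity is tested on a \<open>z\<close> with \<open>m \<cdot> z\<close> zero: the cokernel
  \<open>q\<close> of \<open>z\<close> turns out to have a left inverse, which forces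
  \<open>z\<close> to vanish.\<close>

lemma image_factorization:
  assumes f: "f \<in> Hom A X Y" and k: "is_kernel A f k" and p: "is_cokernel A k p"
  obtains m where "m \<in> Hom A (Cod A p) Y" "m \<cdot> p = f" "monic A m"
proof -
  let ?Q = "Cod A p"
  note kH = kernel_in_Hom[OF k f]
  note pH = cokernel_in_Hom[OF p kH]
  obtain m where m: "m \<in> Hom A ?Q Y" "m \<cdot> p = f"
    using cokernel_factor[OF p kH f kernel_Comp[OF k f]] .
  have "monic A m"
  proof (rule monicI[OF m(1)])
    fix Z z assume z: "z \<in> Hom A Z ?Q" and mz: "m \<cdot> z = Zero A Z Y"
    obtain q where q: "is_cokernel A z q" using cokernel_exists[OF z] .
    note qH = cokernel_in_Hom[OF q z]
    obtain m' where m': "m' \<in> Hom A (Cod A q) Y" "m' \<cdot> q = m"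
      using cokernel_factor[OF q z m(1) mz] .
    note qp = Comp_in_Hom[OF pH qH]
    have epi: "epic A (q \<cdot> p)"
      by (rule epic_Comp[OF pH cokernel_epic[OF p kH] qH cokernel_epic[OF q z]])
    \<comment> \<open>Since \<open>f\<close> factors through \<open>q \<cdot> p\<close>, the kernel
      \<open>g\<close> of the latter is killed by \<open>f\<close>, hence lifts along
      \<open>k\<close>, hence is killed by \<open>p\<close>.\<close>
    obtain g where g: "is_kernel A (q \<cdot> p) g" using kernel_exists[OF qp] .
    note gH = kernel_in_Hom[OF g qp]
    have "f = m' \<cdot> (q \<cdot> p)" using Comp_assoc[OF pH qH m'(1)] m' m(2) by simp
    then have "f \<cdot> g = m' \<cdot> ((q \<cdot> p) \<cdot> g)" using Comp_assoc[OF gH qp m'(1)] by simp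
    also have "\<dots> = Zero A (Dom A g) Y"
      using kernel_Comp[OF g qp] Comp_Zero[OF m'(1) Dom_Ob[OF gH]] by simp
    finally obtain l where l: "l \<in> Hom A (Dom A g) (Dom A k)" "k \<cdot> l = g"
      using kernel_lift[OF k f gH] by metis
    have "p \<cdot> g = Zero A (Dom A g) ?Q"
      using Comp_assoc[OF l(1) kH pH] l(2) cokernel_Comp[OF p kH] Zero_Comp[OF l(1) Cod_Ob[OF pH]]
      by simp
    moreover have "Cod A (q \<cdot> p) = Cod A q" using qp by (simp add: Hom_def)
    \<comment> \<open>The epimorphism \<open>q \<cdot> p\<close> is the cokernel of its kernel, so
      \<open>p\<close> factors through it; cancelling \<open>p\<close> makes \<open>s\<close> a left
      inverse of \<open>q\<close>.\<close>
    ultimately obtain s where s: "s \<in> Hom A (Cod A q) ?Q" "s \<cdot> (q \<cdot> p) = p"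
      using cokernel_factor[OF epic_is_cokernel_of_kernel[OF qp epi g] gH pH] by metis
    have "s \<cdot> q = Ide A ?Q"
      using Comp_assoc[OF pH qH s(1)] s(2) Ide_Comp[OF pH] Ide_in_Hom[OF Cod_Ob[OF pH]]
      by (intro epicD[OF cokernel_epic[OF p kH] pH Comp_in_Hom[OF qH s(1)]]) auto
    then show "z = Zero A Z ?Q"
      using Comp_assoc[OF z qH s(1)] cokernel_Comp[OF q z] Comp_Zero[OF s(1) Dom_Ob[OF z]]
        Ide_Comp[OF z] by simp
  qed
  then show thesis using that m by blast
qed

text \<open>Dually to \<open>epic_is_cokernel_of_kernel\<close>, \<open>m\<close> is the kernel of
  some \<open>g\<close> that factors through \<open>c\<close>, so whatever \<open>c\<close> kills is
  killed by \<open>g\<close>.\<close>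

lemma monic_is_kernel:
  assumes m: "m \<in> Hom A X Y" "monic A m" and c: "is_cokernel A m c"
  shows "is_kernel A c m"
proof -
  note cH = cokernel_in_Hom[OF c m(1)]
  obtain g where g: "is_kernel A g m" using monic_normal[OF m(2)] by blast
  then have gY: "g \<in> Hom A Y (Cod A g)" using m(1) by (auto simp: is_kernel_def Hom_def)
  have Dm: "Dom A m = X" using m(1) by (simp add: Hom_def)
  obtain l where l: "l \<in> Hom A (Cod A c) (Cod A g)" "l \<cdot> c = g"
    using cokernel_factor[OF c m(1) gY] kernel_Comp[OF g gY] Dm by metis
  show ?thesis
    unfolding is_kernel_def
  proof (intro conjI ballI impI)
    show "c \<in> Ar A" "m \<in> Ar A" "Cod A m = Dom A c" using cH m(1) by (auto simp: Hom_def)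
    show "c \<cdot> m = Zero A (Dom A m) (Cod A c)" using cokernel_Comp[OF c m(1)] Dm by simp
    fix W h assume W: "W \<in> Ob A" and "h \<in> Hom A W (Dom A c)" and ch: "c \<cdot> h = Zero A W (Cod A c)"
    then have h: "h \<in> Hom A W Y" using cH by (auto simp: Hom_def)
    have "g \<cdot> h = Zero A W (Cod A g)"
      using Comp_assoc[OF h cH l(1)] ch l(2) Comp_Zero[OF l(1) W] by simp
    then show "\<exists>!g. g \<in> Hom A W (Dom A m) \<and> m \<cdot> g = h" by (rule kernel_ex1[OF g gY h])
  qed
qed

end


section \<open>Coproducts as filtered colimits of finite coproducts\<close>

text \<open>The index categories in \<open>small_filtered\<close> have objects and arrows in
  \<open>'u\<close>, so the arrow from \<open>a\<close> to \<open>b\<close> is a code, which records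
  its endpoints when \<open>pr\<close> is injective.\<close>

definition preorder_category ::
  "('u \<times> 'u \<Rightarrow> 'u) \<Rightarrow> 'u set \<Rightarrow> ('u \<Rightarrow> 'u \<Rightarrow> bool) \<Rightarrow> ('u, 'u) category" where
  "preorder_category pr P R =
    \<lparr>Ob = P, Ar = {pr (a, b) | a b. a \<in> P \<and> b \<in> P \<and> R a b},
     Dom = \<lambda>\<phi>. fst (inv_into UNIV pr \<phi>), Cod = \<lambda>\<phi>. snd (inv_into UNIV pr \<phi>),
     Ide = \<lambda>a. pr (a, a),
     Comp = \<lambda>\<psi> \<phi>. pr (fst (inv_into UNIV pr \<phi>), snd (inv_into UNIV pr \<psi>))\<rparr>"

lemma preorder_category_Hom:
  assumes "inj pr"
  shows "\<phi> \<in> Hom (preorder_category pr P R) a b \<longleftrightarrow>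
    a \<in> P \<and> b \<in> P \<and> R a b \<and> \<phi> = pr (a, b)"
  using assms by (auto simp: preorder_category_def Hom_def)

text \<open>Parallel arrows coincide, so an identity coequalizes them, and directedness supplies the
  upper bounds.\<close>

lemma preorder_category_filtered:
  assumes pr: "inj pr" and refl: "\<And>a. a \<in> P \<Longrightarrow> R a a"
    and trans: "\<And>a b c. \<lbrakk>a \<in> P; b \<in> P; c \<in> P; R a b; R b c\<rbrakk> \<Longrightarrow> R a c"
    and "P \<noteq> {}" and directed: "\<And>a b. \<lbrakk>a \<in> P; b \<in> P\<rbrakk> \<Longrightarrow> \<exists>c\<in>P. R a c \<and> R b c"
  shows "filtered_category (preorder_category pr P R)" (is "filtered_category ?J")
proof
  note H = preorder_category_Hom[OF pr]
  have Comp: "Comp ?J (pr (b', c)) (pr (a, b)) = pr (a, c)" for a b b' c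
    using pr by (simp add: preorder_category_def)
  show "Ob ?J \<noteq> {}" using \<open>P \<noteq> {}\<close> by (simp add: preorder_category_def)
  show "Dom ?J f \<in> Ob ?J" "Cod ?J f \<in> Ob ?J" if "f \<in> Ar ?J" for f
    using that pr by (auto simp: preorder_category_def)
  show "Ide ?J X \<in> Hom ?J X X" if "X \<in> Ob ?J" for X
    using that refl unfolding H by (simp add: preorder_category_def)
  show "Comp ?J g f \<in> Hom ?J X Z" if "f \<in> Hom ?J X Y" "g \<in> Hom ?J Y Z" for f g X Y Z
    using that trans[of X Y Z] unfolding H by (auto simp: Comp)
  show "Comp ?J f (Ide ?J X) = f" if "f \<in> Hom ?J X Y" for f X Y
  proof -
    have "Ide ?J X = pr (X, X)" by (simp add: preorder_category_def)
    then show ?thesis using that unfolding H by (auto simp: Comp)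
  qed
  show "Comp ?J (Ide ?J Y) f = f" if "f \<in> Hom ?J X Y" for f X Y
  proof -
    have "Ide ?J Y = pr (Y, Y)" by (simp add: preorder_category_def)
    then show ?thesis using that unfolding H by (auto simp: Comp)
  qed
  show "Comp ?J (Comp ?J h g) f = Comp ?J h (Comp ?J g f)"
    if "f \<in> Hom ?J W X" "g \<in> Hom ?J X Y" "h \<in> Hom ?J Y Z" for f g h W X Y Z
    using that unfolding H by (auto simp: Comp)
  show "\<exists>k\<in>Ob ?J. Hom ?J i k \<noteq> {} \<and> Hom ?J j k \<noteq> {}" if "i \<in> Ob ?J" "j \<in> Ob ?J" for i j
  proof -
    have ij: "i \<in> P" "j \<in> P" using that by (auto simp: preorder_category_def)
    obtain k where k: "k \<in> P" "R i k" "R j k" using directed[OF ij] by blast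
    then have "pr (i, k) \<in> Hom ?J i k" "pr (j, k) \<in> Hom ?J j k" "k \<in> Ob ?J"
      using ij unfolding H by (auto simp: preorder_category_def)
    then show ?thesis by blast
  qed
  show "\<exists>k\<in>Ob ?J. \<exists>\<chi>\<in>Hom ?J j k. Comp ?J \<chi> \<phi> = Comp ?J \<chi> \<psi>"
    if "\<phi> \<in> Hom ?J i j" "\<psi> \<in> Hom ?J i j" for i j \<phi> \<psi>
  proof -
    have "\<phi> = \<psi>" "j \<in> P" using that unfolding H by auto
    moreover have "pr (j, j) \<in> Hom ?J j j" unfolding H using \<open>j \<in> P\<close> refl by simp
    moreover have "j \<in> Ob ?J" using \<open>j \<in> P\<close> by (simp add: preorder_category_def)
    ultimately show ?thesis by blast
  qed
qed

text \<open>An arrow carries no more information than its endpoints, so functoriality amounts to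
  coherence of the transition morphisms \<open>t\<close>.\<close>

lemma preorder_category_functor:
  assumes J: "category (preorder_category pr P R)" and A: "category A" and pr: "inj pr"
    and Fo: "\<And>a. a \<in> P \<Longrightarrow> Fo a \<in> Ob A"
    and t: "\<And>a b. \<lbrakk>a \<in> P; b \<in> P; R a b\<rbrakk> \<Longrightarrow> t a b \<in> Hom A (Fo a) (Fo b)"
    and t_id: "\<And>a. a \<in> P \<Longrightarrow> t a a = Ide A (Fo a)"
    and t_comp: "\<And>a b c. \<lbrakk>a \<in> P; b \<in> P; c \<in> P; R a b; R b c\<rbrakk> \<Longrightarrow>
      t a c = t b c \<cdot>\<^bsub>A\<^esub> t a b"
  shows "cat_functor (preorder_category pr P R) A Fo
    (\<lambda>\<phi>. t (fst (inv_into UNIV pr \<phi>)) (snd (inv_into UNIV pr \<phi>)))"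
proof -
  note H = preorder_category_Hom[OF pr]
  show ?thesis
    using J A
  proof (rule cat_functor.intro[OF _ _ cat_functor_axioms.intro], goal_cases)
    case (1 i)
    then show ?case using Fo by (simp add: preorder_category_def)
  next
    case (2 \<phi> i j)
    then show ?case using t pr unfolding H by auto
  next
    case (3 i)
    then show ?case using t_id pr by (simp add: preorder_category_def)
  next
    case (4 \<phi> i j \<psi> k)
    then show ?case using t_comp[of i j k] pr unfolding H by (auto simp: preorder_category_def)
  qed
qed

context grothendieck_category
begin

text \<open>A coproduct is the filtered colimit of its finite subcoproducts along split
  monomorphisms, so \<open>x\<close> factors through one of them; the projections of that biproduct
  split \<open>x\<close> into finitely many components.\<close>

lemma finitely_generated_coproduct:
  fixes I :: "'u set"
  assumes "universe U" and I: "small U I"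
    and S: "is_coproduct A I X S \<iota>" and G: "finitely_generated U A G" and x: "x \<in> Hom A G S"
  obtains F y where "F \<subseteq> I" "finite F" "\<And>i. i \<in> F \<Longrightarrow> y i \<in> Hom A G (X i)"
    and "x = hom_sum G S (\<lambda>i. \<iota> i \<cdot> y i) F"
proof -
  interpret U: universe U by (rule assms(1))
  have SO: "S \<in> Ob A" by (rule Cod_Ob[OF x])
  have GO: "G \<in> Ob A" by (rule Dom_Ob[OF x])
  note \<iota> = coproduct_injection[OF S]
  \<comment> \<open>The finite subsets of \<open>I\<close>, ordered by inclusion, index the diagram;
    \<open>enc\<close> transports them to \<open>'u\<close>, as \<open>small_filtered\<close>
    demands.\<close>
  define Fin where "Fin = {F. F \<subseteq> I \<and> finite F}"
  have small_Fin: "small U Fin" unfolding Fin_def by (rule U.small_finite_subsets[OF I])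
  obtain enc :: "'u set \<Rightarrow> 'u" where enc: "inj_on enc Fin" using small_inj_on[OF small_Fin] .
  obtain pr :: "'u \<times> 'u \<Rightarrow> 'u" where pr: "inj pr" using U.pairing .
  define P where "P = enc ` Fin"
  define dec where "dec = inv_into Fin enc"
  have dec: "dec a \<in> Fin" if "a \<in> P" for a using that unfolding P_def dec_def by (rule inv_into_into)
  have dec_enc: "dec (enc F) = F" if "F \<in> Fin" for F using that enc by (simp add: dec_def)
  define R where "R a b \<longleftrightarrow> dec a \<subseteq> dec b" for a b
  define J where "J = preorder_category pr P R"
  have XO: "X i \<in> Ob A" if "i \<in> I" for i by (rule Dom_Ob[OF \<iota>[OF that]])
  have "\<exists>T \<kappa>. is_coproduct A F X T \<kappa>" if "F \<in> Fin" for F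
    using that XO by (intro small_coproducts U.small_finite) (auto simp: Fin_def)
  then obtain T \<kappa> where T: "\<And>F. F \<in> Fin \<Longrightarrow> is_coproduct A F X (T F) (\<kappa> F)" by metis
  have TO: "T F \<in> Ob A" if "F \<in> Fin" for F using T[OF that] by (simp add: is_coproduct_def)
  note \<kappa> = coproduct_injection[OF T]
  have "\<exists>t. t \<in> Hom A (T F) (T F') \<and> (\<forall>i\<in>F. t \<cdot> \<kappa> F i = \<kappa> F' i)"
    if FF: "F \<in> Fin" "F' \<in> Fin" "F \<subseteq> F'" for F F'
  proof -
    have "\<kappa> F' i \<in> Hom A (X i) (T F')" if "i \<in> F" for i
      using \<kappa>[OF FF(2)] that FF(3) by blast
    then obtain t where "t \<in> Hom A (T F) (T F')" "\<And>i. i \<in> F \<Longrightarrow> t \<cdot> \<kappa> F i = \<kappa> F' i"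
      using coproduct_lift[OF T[OF FF(1)] TO[OF FF(2)], of "\<kappa> F'"] by blast
    then show ?thesis by blast
  qed
  then obtain t where t: "\<And>F F'. \<lbrakk>F \<in> Fin; F' \<in> Fin; F \<subseteq> F'\<rbrakk> \<Longrightarrow> t F F' \<in> Hom A (T F) (T F')"
    and t\<kappa>: "\<And>F F' i. \<lbrakk>F \<in> Fin; F' \<in> Fin; F \<subseteq> F'; i \<in> F\<rbrakk> \<Longrightarrow> t F F' \<cdot> \<kappa> F i = \<kappa> F' i" by metis
  have "\<exists>j. j \<in> Hom A (T F) S \<and> (\<forall>i\<in>F. j \<cdot> \<kappa> F i = \<iota> i)" if F: "F \<in> Fin" for F
  proof -
    have "\<iota> i \<in> Hom A (X i) S" if "i \<in> F" for i using F that \<iota> by (auto simp: Fin_def)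
    then obtain j where "j \<in> Hom A (T F) S" "\<And>i. i \<in> F \<Longrightarrow> j \<cdot> \<kappa> F i = \<iota> i"
      using coproduct_lift[OF T[OF F] SO, of \<iota>] by blast
    then show ?thesis by blast
  qed
  then obtain j where j: "\<And>F. F \<in> Fin \<Longrightarrow> j F \<in> Hom A (T F) S"
    and j\<kappa>: "\<And>F i. F \<in> Fin \<Longrightarrow> i \<in> F \<Longrightarrow> j F \<cdot> \<kappa> F i = \<iota> i" by metis
  have t_id: "t F F = Ide A (T F)" if F: "F \<in> Fin" for F
    by (rule coproduct_eqI[OF T[OF F] t[OF F F order_refl] Ide_in_Hom[OF TO[OF F]]])
      (simp add: t\<kappa>[OF F F] Ide_Comp[OF \<kappa>[OF F]])
  have t_comp: "t F F'' = t F' F'' \<cdot> t F F'"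
    if F: "F \<in> Fin" "F' \<in> Fin" "F'' \<in> Fin" and sub: "F \<subseteq> F'" "F' \<subseteq> F''" for F F' F''
  proof (rule coproduct_eqI[OF T[OF F(1)] t[OF F(1,3) order_trans[OF sub]]
        Comp_in_Hom[OF t[OF F(1,2) sub(1)] t[OF F(2,3) sub(2)]]])
    fix i assume i: "i \<in> F"
    then have "i \<in> F'" using sub by blast
    then show "t F F'' \<cdot> \<kappa> F i = (t F' F'' \<cdot> t F F') \<cdot> \<kappa> F i"
      using Comp_assoc[OF \<kappa>[OF F(1) i] t[OF F(1,2) sub(1)] t[OF F(2,3) sub(2)]]
        t\<kappa>[OF F(1,3) order_trans[OF sub] i] t\<kappa>[OF F(1,2) sub(1) i] t\<kappa>[OF F(2,3) sub(2)] by simp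
  qed
  have jt: "j F' \<cdot> t F F' = j F" if F: "F \<in> Fin" "F' \<in> Fin" and sub: "F \<subseteq> F'" for F F'
  proof (rule coproduct_eqI[OF T[OF F(1)] Comp_in_Hom[OF t[OF F sub] j[OF F(2)]] j[OF F(1)]])
    fix i assume i: "i \<in> F"
    then have "i \<in> F'" using sub by blast
    then show "(j F' \<cdot> t F F') \<cdot> \<kappa> F i = j F \<cdot> \<kappa> F i"
      using Comp_assoc[OF \<kappa>[OF F(1) i] t[OF F sub] j[OF F(2)]] t\<kappa>[OF F sub i]
        j\<kappa>[OF F(2)] j\<kappa>[OF F(1) i] by simp
  qed
  have filtered: "filtered_category J"
    unfolding J_def
  proof (rule preorder_category_filtered[OF pr])
    show "P \<noteq> {}" by (auto simp: P_def Fin_def)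
    fix a b assume ab: "a \<in> P" "b \<in> P"
    then have F: "dec a \<union> dec b \<in> Fin" using dec[OF ab(1)] dec[OF ab(2)] by (simp add: Fin_def)
    show "\<exists>c\<in>P. R a c \<and> R b c"
      using F by (intro bexI[of _ "enc (dec a \<union> dec b)"]) (auto simp: R_def dec_enc P_def)
  qed (auto simp: R_def)
  interpret J: filtered_category J by (rule filtered)
  have small_P: "small U P" unfolding P_def by (rule small_image[OF small_Fin])
  have "Ar J \<subseteq> pr ` (P \<times> P)" by (auto simp: J_def preorder_category_def)
  then have "small U (Ar J)"
    by (rule small_lepoll[OF subset_imp_lepoll small_image[OF U.small_Times[OF small_P small_P]]])
  then have small_J: "small_filtered U J"
    using filtered small_P by (simp add: small_filtered_def J_def preorder_category_def)
  define Fo where "Fo a = T (dec a)" for a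
  define Fa where "Fa \<phi> = t (dec (fst (inv_into UNIV pr \<phi>))) (dec (snd (inv_into UNIV pr \<phi>)))" for \<phi>
  have JH: "\<phi> \<in> Hom J a b \<longleftrightarrow> a \<in> P \<and> b \<in> P \<and> dec a \<subseteq> dec b \<and> \<phi> = pr (a, b)" for \<phi> a b
    unfolding J_def preorder_category_Hom[OF pr] R_def by simp
  have JO: "Ob J = P" by (simp add: J_def preorder_category_def)
  have Fa_pr: "Fa (pr (a, b)) = t (dec a) (dec b)" for a b using pr by (simp add: Fa_def)
  have diagram: "cat_functor J A Fo Fa"
    unfolding J_def Fa_def Fo_def
    by (rule preorder_category_functor[OF J.category_axioms[unfolded J_def] category_axioms pr,
          where t = "\<lambda>a b. t (dec a) (dec b)"])
      (auto simp: R_def TO t t_id dec intro!: t_comp)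
  have monic: "\<forall>\<phi>\<in>Ar J. monic A (Fa \<phi>)"
  proof
    fix \<phi> assume "\<phi> \<in> Ar J"
    then have "\<phi> \<in> Hom J (Dom J \<phi>) (Cod J \<phi>)" by (simp add: Hom_def)
    then obtain a b where ab: "a \<in> P" "b \<in> P" "dec a \<subseteq> dec b" "\<phi> = pr (a, b)" unfolding JH by blast
    then show "monic A (Fa \<phi>)" unfolding ab(4) Fa_pr
      by (intro monic_subcoproduct[OF T T]) (auto intro!: dec t t\<kappa>)
  qed
  have cocone: "is_cocone J A Fo Fa S (\<lambda>a. j (dec a))"
    unfolding is_cocone_def JO
  proof (intro conjI ballI allI SO)
    show "j (dec a) \<in> Hom A (Fo a) S" if "a \<in> P" for a
      unfolding Fo_def by (rule j[OF dec[OF that]])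
    show "j (dec b) \<cdot> Fa \<phi> = j (dec a)" if "\<phi> \<in> Hom J a b" for a b \<phi>
      using that jt dec unfolding JH by (auto simp: Fa_pr)
  qed
  have colimit: "is_colimit J A Fo Fa S (\<lambda>a. j (dec a))"
    unfolding is_colimit_def
  proof (intro conjI allI impI cocone)
    fix N \<nu> assume N: "is_cocone J A Fo Fa N \<nu>"
    then have NO: "N \<in> Ob A" and \<nu>: "\<And>a. a \<in> P \<Longrightarrow> \<nu> a \<in> Hom A (T (dec a)) N"
      by (auto simp: is_cocone_def JO Fo_def)
    have \<nu>t: "\<nu> b \<cdot> t (dec a) (dec b) = \<nu> a" if "a \<in> P" "b \<in> P" "dec a \<subseteq> dec b" for a b
    proof -
      have "pr (a, b) \<in> Hom J a b" using that unfolding JH by simp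
      then show ?thesis using N Fa_pr unfolding is_cocone_def by metis
    qed
    \<comment> \<open>A cocone is determined by its legs at singletons: restricted to the summands
      \<open>X i\<close>, they induce the mediating morphism \<open>m\<close> from
      \<open>S\<close>.\<close>
    define s where "s i = enc {i}" for i
    have Fin1: "{i} \<in> Fin" if "i \<in> I" for i using that by (simp add: Fin_def)
    have s: "s i \<in> P" "dec (s i) = {i}" if "i \<in> I" for i
      using Fin1[OF that] by (auto simp: s_def P_def dec_enc)
    have \<kappa>1: "\<kappa> {i} i \<in> Hom A (X i) (T {i})" if "i \<in> I" for i by (rule \<kappa>[OF Fin1[OF that]]) simp
    have \<nu>s: "\<nu> (s i) \<in> Hom A (T {i}) N" if "i \<in> I" for i using \<nu>[OF s(1)[OF that]] s(2)[OF that] by simp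
    obtain m where m: "m \<in> Hom A S N" "\<And>i. i \<in> I \<Longrightarrow> m \<cdot> \<iota> i = \<nu> (s i) \<cdot> \<kappa> {i} i"
      using coproduct_lift[OF S NO Comp_in_Hom[OF \<kappa>1 \<nu>s]] by blast
    show "\<exists>!m. m \<in> Hom A S N \<and> (\<forall>a\<in>Ob J. m \<cdot> j (dec a) = \<nu> a)"
      unfolding JO
    proof (intro ex1I[of _ m] conjI ballI m(1))
      fix a assume a: "a \<in> P"
      note F = dec[OF a]
      show "m \<cdot> j (dec a) = \<nu> a"
      proof (rule coproduct_eqI[OF T[OF F] Comp_in_Hom[OF j[OF F] m(1)] \<nu>[OF a]])
        fix i assume i: "i \<in> dec a"
        then have iI: "i \<in> I" using F by (auto simp: Fin_def)
        have sub: "{i} \<subseteq> dec a" using i by simp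
        have "(m \<cdot> j (dec a)) \<cdot> \<kappa> (dec a) i = \<nu> (s i) \<cdot> \<kappa> {i} i"
          using Comp_assoc[OF \<kappa>[OF F i] j[OF F] m(1)] j\<kappa>[OF F i] m(2)[OF iI] by simp
        also have "\<dots> = (\<nu> a \<cdot> t {i} (dec a)) \<cdot> \<kappa> {i} i"
          using \<nu>t[OF s(1)[OF iI] a] s(2)[OF iI] i by simp
        also have "\<dots> = \<nu> a \<cdot> \<kappa> (dec a) i"
          using Comp_assoc[OF \<kappa>1[OF iI] t[OF Fin1[OF iI] F sub] \<nu>[OF a]]
            t\<kappa>[OF Fin1[OF iI] F sub] by simp
        finally show "(m \<cdot> j (dec a)) \<cdot> \<kappa> (dec a) i = \<nu> a \<cdot> \<kappa> (dec a) i" .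
      qed
    next
      fix m' assume m': "m' \<in> Hom A S N \<and> (\<forall>a\<in>P. m' \<cdot> j (dec a) = \<nu> a)"
      show "m' = m"
      proof (rule coproduct_eqI[OF S _ m(1)])
        show m'H: "m' \<in> Hom A S N" using m' by simp
        fix i assume i: "i \<in> I"
        have "m' \<cdot> j {i} = \<nu> (s i)" using m' s[OF i] by metis
        then show "m' \<cdot> \<iota> i = m \<cdot> \<iota> i"
          using Comp_assoc[OF \<kappa>1[OF i] j[OF Fin1[OF i]] m'H] j\<kappa>[OF Fin1[OF i], of i] m(2)[OF i]
          by simp
      qed
    qed
  qed
  have "hom_preserves_colimit J A Fo Fa S (\<lambda>a. j (dec a)) G"
    using G small_J diagram monic colimit unfolding finitely_generated_def by blast
  then obtain a f where a: "a \<in> Ob J" and "f \<in> Hom A G (Fo a)" and xf: "x = j (dec a) \<cdot> f"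
    using hom_preserves_colimit_factor[OF diagram cocone _ x] by metis
  define F where "F = dec a"
  have F: "F \<in> Fin" using a dec by (simp add: F_def JO)
  then have fin: "finite F" by (simp add: Fin_def)
  have f: "f \<in> Hom A G (T F)" using \<open>f \<in> Hom A G (Fo a)\<close> by (simp add: Fo_def F_def)
  \<comment> \<open>Inserting this resolution of the identity between \<open>f\<close> and
    \<open>j F\<close> expands \<open>x\<close> into a sum with components
    \<open>\<pi> i \<cdot> f\<close>.\<close>
  obtain \<pi> where \<pi>: "\<And>i. i \<in> F \<Longrightarrow> \<pi> i \<in> Hom A (T F) (X i)"
    and sum: "hom_sum (T F) (T F) (\<lambda>i. \<kappa> F i \<cdot> \<pi> i) F = Ide A (T F)"
    using finite_coproduct_decomposition[OF T[OF F] fin] by blast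
  note \<kappa>\<pi> = Comp_in_Hom[OF \<pi> \<kappa>[OF F]]
  show thesis
  proof
    show "F \<subseteq> I" "finite F" using F by (auto simp: Fin_def)
    show "\<pi> i \<cdot> f \<in> Hom A G (X i)" if "i \<in> F" for i by (rule Comp_in_Hom[OF f \<pi>[OF that]])
    have "x = j F \<cdot> (hom_sum (T F) (T F) (\<lambda>i. \<kappa> F i \<cdot> \<pi> i) F \<cdot> f)"
      unfolding sum Ide_Comp[OF f] using xf by (simp add: F_def)
    also have "\<dots> = hom_sum G S (\<lambda>i. j F \<cdot> ((\<kappa> F i \<cdot> \<pi> i) \<cdot> f)) F"
      using Comp_in_Hom[OF f \<kappa>\<pi>]
      by (simp add: hom_sum_Comp[OF f TO[OF F] fin \<kappa>\<pi>] Comp_hom_sum[OF j[OF F] GO fin])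
    also have "\<dots> = hom_sum G S (\<lambda>i. \<iota> i \<cdot> (\<pi> i \<cdot> f)) F"
    proof (rule hom_sum_cong[OF GO SO])
      fix i assume i: "i \<in> F"
      note \<pi>f = Comp_in_Hom[OF f \<pi>[OF i]]
      have iI: "i \<in> I" using i F by (auto simp: Fin_def)
      show "\<iota> i \<cdot> (\<pi> i \<cdot> f) \<in> Hom A G S" by (rule Comp_in_Hom[OF \<pi>f \<iota>[OF iI]])
      show "j F \<cdot> ((\<kappa> F i \<cdot> \<pi> i) \<cdot> f) = \<iota> i \<cdot> (\<pi> i \<cdot> f)"
        using Comp_assoc[OF f \<pi>[OF i] \<kappa>[OF F i]] Comp_assoc[OF \<pi>f \<kappa>[OF F i] j[OF F]]
          j\<kappa>[OF F i] by simp
    qed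
    finally show "x = hom_sum G S (\<lambda>i. \<iota> i \<cdot> (\<pi> i \<cdot> f)) F" .
  qed
qed

end


section \<open>Serre isomorphisms\<close>

text \<open>Precomposition with \<open>u\<close> is additive, so it is a group isomorphism exactly
  when it is bijective.\<close>

lemma (in preadditive_category) hom_map_iso_iff:
  assumes u: "u \<in> Hom A X Y" and L: "L \<in> Ob A"
  shows "hom_map_iso A u L \<longleftrightarrow> (\<forall>v\<in>Hom A X L. \<exists>!w. w \<in> Hom A Y L \<and> w \<cdot> u = v)"
proof -
  have "(\<lambda>f. f \<cdot> u) \<in> hom (hom_group A Y L) (hom_group A X L)"
    using Comp_in_Hom[OF u] Comp_Add_left[OF u] by (auto simp: hom_def)
  moreover have "Dom A u = X" "Cod A u = Y" using u by (auto simp: Hom_def)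
  ultimately have "hom_map_iso A u L \<longleftrightarrow> bij_betw (\<lambda>f. f \<cdot> u) (Hom A Y L) (Hom A X L)"
    by (simp add: hom_map_iso_def iso_def)
  also have "\<dots> \<longleftrightarrow> (\<forall>v\<in>Hom A X L. \<exists>!w. w \<in> Hom A Y L \<and> w \<cdot> u = v)"
  proof
    assume "bij_betw (\<lambda>f. f \<cdot> u) (Hom A Y L) (Hom A X L)"
    then have inj: "inj_on (\<lambda>f. f \<cdot> u) (Hom A Y L)"
      and surj: "Hom A X L = (\<lambda>f. f \<cdot> u) ` Hom A Y L" by (auto simp: bij_betw_def)
    show "\<forall>v\<in>Hom A X L. \<exists>!w. w \<in> Hom A Y L \<and> w \<cdot> u = v"
    proof
      fix v assume "v \<in> Hom A X L"
      then obtain w where "w \<in> Hom A Y L" "w \<cdot> u = v" unfolding surj by blast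
      then show "\<exists>!w. w \<in> Hom A Y L \<and> w \<cdot> u = v"
        using inj_onD[OF inj] by (intro ex1I[of _ w]) auto
    qed
  next
    assume ex1: "\<forall>v\<in>Hom A X L. \<exists>!w. w \<in> Hom A Y L \<and> w \<cdot> u = v"
    have "inj_on (\<lambda>f. f \<cdot> u) (Hom A Y L)"
    proof (rule inj_onI)
      fix f g assume f: "f \<in> Hom A Y L" and g: "g \<in> Hom A Y L" and "f \<cdot> u = g \<cdot> u"
      then show "f = g" using ex1[rule_format, OF Comp_in_Hom[OF u f]] by metis
    qed
    moreover have "(\<lambda>f. f \<cdot> u) ` Hom A Y L = Hom A X L"
    proof (intro equalityI subsetI)
      show "v \<in> Hom A X L" if "v \<in> (\<lambda>f. f \<cdot> u) ` Hom A Y L" for v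
        using that Comp_in_Hom[OF u] by blast
      show "v \<in> (\<lambda>f. f \<cdot> u) ` Hom A Y L" if "v \<in> Hom A X L" for v
        using ex1_implies_ex[OF ex1[rule_format, OF that]] by blast
    qed
    ultimately show "bij_betw (\<lambda>f. f \<cdot> u) (Hom A Y L) (Hom A X L)" by (simp add: bij_betw_def)
  qed
  finally show ?thesis .
qed

context abelian_category
begin

text \<open>The cokernel of the kernel of \<open>f\<close> is the image of \<open>f\<close>, a
  subobject of an object of \<open>\<C>\<close>.\<close>

lemma serre_image:
  assumes \<C>: "serre_subcategory A \<C>" and f: "f \<in> Hom A X C" and C: "C \<in> \<C>"
    and k: "is_kernel A f k" and p: "is_cokernel A k p"
  shows "Cod A p \<in> \<C>"
proof -
  obtain m where m: "m \<in> Hom A (Cod A p) C" "monic A m"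
    using image_factorization[OF f k p] by metis
  then have "Cod A m \<in> \<C>" "Dom A m = Cod A p" using C by (auto simp: Hom_def)
  then show ?thesis using \<C> m(2) unfolding serre_subcategory_def by metis
qed

text \<open>The cokernel object of \<open>k\<close> is the image of \<open>f\<close>, covered by
  \<open>serre_image\<close>; the kernel object of \<open>k\<close> is zero because \<open>k\<close>
  is monic.\<close>

lemma serre_iso_kernel:
  assumes \<C>: "serre_subcategory A \<C>" and f: "f \<in> Hom A X C" and C: "C \<in> \<C>"
    and k: "is_kernel A f k"
  shows "serre_iso A \<C> k"
proof -
  note kH = kernel_in_Hom[OF k f]
  have CO: "C \<in> Ob A" by (rule Cod_Ob[OF f])
  obtain p where p: "is_cokernel A k p" using cokernel_exists[OF kH] .
  obtain l where l: "is_kernel A k l" using kernel_exists[OF kH] .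
  note lH = kernel_in_Hom[OF l kH]
  note Z = Zero_in_Hom[OF Dom_Ob[OF lH] CO]
  have l0: "l = Zero A (Dom A l) (Dom A k)"
    by (rule monic_Zero[OF kH kernel_monic[OF k f] lH kernel_Comp[OF l kH]])
  \<comment> \<open>The object \<open>Dom A l\<close> is zero, so its zero morphism to
    \<open>C\<close> is monic; closure under subobjects then places it in
    \<open>\<C>\<close>.\<close>
  have "monic A (Zero A (Dom A l) C)"
  proof (rule monicI[OF Z])
    fix W h assume h: "h \<in> Hom A W (Dom A l)"
    have "l \<cdot> h = Zero A W (Dom A k)" by (subst l0) (rule Zero_Comp[OF h Dom_Ob[OF kH]])
    then show "h = Zero A W (Dom A l)" by (rule monic_Zero[OF lH kernel_monic[OF l kH] h])
  qed
  moreover have "Cod A (Zero A (Dom A l) C) \<in> \<C>" "Dom A (Zero A (Dom A l) C) = Dom A l"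
    using Z C by (auto simp: Hom_def)
  ultimately have "Dom A l \<in> \<C>" using \<C> unfolding serre_subcategory_def by metis
  then show ?thesis
    using kH l p serre_image[OF \<C> f C k p] unfolding serre_iso_def Hom_def by blast
qed

text \<open>A morphism that kills the kernel of \<open>f\<close> factors through the image of
  \<open>f\<close>, which lies in \<open>\<C>\<close> and so has only the zero morphism to
  \<open>L\<close>.\<close>

lemma torsion_free_kernel_Zero:
  assumes \<C>: "serre_subcategory A \<C>"
    and tf: "\<forall>C\<in>\<C>. \<forall>f\<in>Hom A C L. f = Zero A C L"
    and f: "f \<in> Hom A X C" "C \<in> \<C>" "is_kernel A f k"
    and w: "w \<in> Hom A X L" "w \<cdot> k = Zero A (Dom A k) L"
  shows "w = Zero A X L"
proof -
  note kH = kernel_in_Hom[OF f(3,1)]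
  obtain p where p: "is_cokernel A k p" using cokernel_exists[OF kH] .
  obtain w' where w': "w' \<in> Hom A (Cod A p) L" "w' \<cdot> p = w" using cokernel_factor[OF p kH w] .
  have "w' = Zero A (Cod A p) L" using tf serre_image[OF \<C> f p] w'(1) by blast
  then show ?thesis using Zero_Comp[OF cokernel_in_Hom[OF p kH] Cod_Ob[OF w(1)]] w'(2) by simp
qed

text \<open>Iterated kernels give a subobject on which all \<open>f i\<close> vanish at once, and
  each stage keeps the property that a morphism to \<open>L\<close> vanishing there is zero.\<close>

lemma torsion_free_common_kernel:
  assumes \<C>: "serre_subcategory A \<C>"
    and tf: "\<forall>C\<in>\<C>. \<forall>f\<in>Hom A C L. f = Zero A C L"
    and C: "C \<in> \<C>" and X: "X \<in> Ob A" and L: "L \<in> Ob A"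
    and "finite F" "\<And>i. i \<in> F \<Longrightarrow> f i \<in> Hom A X C"
  obtains K k where "k \<in> Hom A K X" "\<And>i. i \<in> F \<Longrightarrow> f i \<cdot> k = Zero A K C"
    and "\<And>w. w \<in> Hom A X L \<Longrightarrow> w \<cdot> k = Zero A K L \<Longrightarrow> w = Zero A X L"
proof -
  have CO: "C \<in> Ob A" using \<C> C by (auto simp: serre_subcategory_def)
  have "\<exists>K k. k \<in> Hom A K X \<and> (\<forall>i\<in>F. f i \<cdot> k = Zero A K C) \<and>
      (\<forall>w\<in>Hom A X L. w \<cdot> k = Zero A K L \<longrightarrow> w = Zero A X L)"
    using assms(6,7)
  proof (induction F rule: finite_induct)
    case empty
    then show ?case using Ide_in_Hom[OF X] Comp_Ide by (intro exI[of _ X] exI[of _ "Ide A X"]) auto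
  next
    case (insert i F)
    then obtain K k where k: "k \<in> Hom A K X" "\<And>j. j \<in> F \<Longrightarrow> f j \<cdot> k = Zero A K C"
      "\<And>w. w \<in> Hom A X L \<Longrightarrow> w \<cdot> k = Zero A K L \<Longrightarrow> w = Zero A X L" by auto
    have fi: "f i \<in> Hom A X C" using insert.prems by simp
    note fk = Comp_in_Hom[OF k(1) fi]
    \<comment> \<open>Pass to the kernel of \<open>f i\<close> restricted to \<open>K\<close>;
      \<open>torsion_free_kernel_Zero\<close> carries vanishing on \<open>Dom A l\<close> back to
      \<open>K\<close>.\<close>
    obtain l where l: "is_kernel A (f i \<cdot> k) l" using kernel_exists[OF fk] .
    note lH = kernel_in_Hom[OF l fk]
    show ?case
    proof (intro exI[of _ "Dom A l"] exI[of _ "k \<cdot> l"] conjI ballI impI)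
      show "k \<cdot> l \<in> Hom A (Dom A l) X" by (rule Comp_in_Hom[OF lH k(1)])
      show "f j \<cdot> (k \<cdot> l) = Zero A (Dom A l) C" if "j \<in> insert i F" for j
      proof (cases "j = i")
        case True
        then show ?thesis using Comp_assoc[OF lH k(1) fi] kernel_Comp[OF l fk] by simp
      next
        case False
        then have "j \<in> F" using that by simp
        then show ?thesis
          using Comp_assoc[OF lH k(1), of "f j" C] insert.prems k(2) Zero_Comp[OF lH CO] by simp
      qed
      fix w assume w: "w \<in> Hom A X L" and 0: "w \<cdot> (k \<cdot> l) = Zero A (Dom A l) L"
      have "w \<cdot> k = Zero A K L"
        using Comp_assoc[OF lH k(1) w] 0
        by (intro torsion_free_kernel_Zero[OF \<C> tf fk C l Comp_in_Hom[OF k(1) w]]) auto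
      then show "w = Zero A X L" by (rule k(3)[OF w])
    qed
  qed
  then show thesis using that by blast
qed

end

section \<open>Extension of morphisms to \<open>L\<close>, assembled from generators\<close>

context grothendieck_category
begin

text \<open>
  The hypothesis \<open>ext\<close> says that \<open>h\<close> agrees with \<open>g\<close> on the pullback of
  \<open>m\<close> along \<open>e\<close>, stated on generalized elements so that no pullback has to be chosen.
\<close>

lemma extend_along_generators:
  assumes "universe U" and \<C>: "serre_subcategory A \<C>"
    and tf: "\<forall>C\<in>\<C>. \<forall>f\<in>Hom A C L. f = Zero A C L"
    and \<G>: "small U \<G>" "generating A \<G>" "\<And>G. G \<in> \<G> \<Longrightarrow> finitely_generated U A G"
    and C: "C \<in> \<C>" and c: "c \<in> Hom A B C" and m: "m \<in> Hom A X B" and cm: "is_kernel A c m"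
    and g: "g \<in> Hom A X L"
    and ext: "\<And>G e. G \<in> \<G> \<Longrightarrow> e \<in> Hom A G B \<Longrightarrow> \<exists>h\<in>Hom A G L. \<forall>W y a.
      y \<in> Hom A W G \<longrightarrow> a \<in> Hom A W X \<longrightarrow> e \<cdot> y = m \<cdot> a \<longrightarrow> h \<cdot> y = g \<cdot> a"
  obtains r where "r \<in> Hom A B L" "r \<cdot> m = g"
proof -
  interpret U: universe U by (rule assms(1))
  have BO: "B \<in> Ob A" and LO: "L \<in> Ob A" and XO: "X \<in> Ob A"
    using Dom_Ob[OF c] Cod_Ob[OF g] Dom_Ob[OF g] by auto
  have m_mono: "monic A m" by (rule kernel_monic[OF cm c])
  have Dm: "Dom A m = X" using m by (simp add: Hom_def)
  have GO: "G \<in> Ob A" if "G \<in> \<G>" for G using that \<G>(2) by (auto simp: generating_def)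
  \<comment> \<open>All morphisms from generators to \<open>B\<close> form a small set; codes in
    \<open>'u\<close> make it an admissible index set for \<open>small_coproducts\<close>.\<close>
  define E where "E = (\<Union>G\<in>\<G>. Hom A G B)"
  have small_E: "small U E"
    unfolding E_def using GO BO by (intro U.small_Union \<G>(1) locally_small)
  obtain enc :: "'m \<Rightarrow> 'u" where enc: "inj_on enc E" using small_inj_on[OF small_E] .
  define I where "I = enc ` E"
  define ev where "ev = inv_into E enc"
  define Y where "Y i = Dom A (ev i)" for i
  have small_I: "small U I" unfolding I_def by (rule small_image[OF small_E])
  have ev: "ev i \<in> Hom A (Y i) B" "Y i \<in> \<G>" if "i \<in> I" for i
  proof -
    have "ev i \<in> E" using that unfolding I_def ev_def by (rule inv_into_into)
    then show "ev i \<in> Hom A (Y i) B" "Y i \<in> \<G>" by (auto simp: E_def Y_def Hom_def)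
  qed
  have index: "\<exists>i\<in>I. Y i = G \<and> ev i = e" if "G \<in> \<G>" "e \<in> Hom A G B" for G e
  proof
    have "e \<in> E" using that by (auto simp: E_def)
    then show "enc e \<in> I" by (simp add: I_def)
    have "ev (enc e) = e" using \<open>e \<in> E\<close> enc by (simp add: ev_def)
    then show "Y (enc e) = G \<and> ev (enc e) = e" using that(2) by (simp add: Y_def Hom_def)
  qed
  have "\<exists>h. h \<in> Hom A (Y i) L \<and> (\<forall>W y a. y \<in> Hom A W (Y i) \<longrightarrow> a \<in> Hom A W X \<longrightarrow>
      ev i \<cdot> y = m \<cdot> a \<longrightarrow> h \<cdot> y = g \<cdot> a)" if "i \<in> I" for i
    using ext[OF ev(2,1)[OF that]] by blast
  then obtain h where h: "\<And>i. i \<in> I \<Longrightarrow> h i \<in> Hom A (Y i) L"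
    and h_ext: "\<And>i W y a. \<lbrakk>i \<in> I; y \<in> Hom A W (Y i); a \<in> Hom A W X; ev i \<cdot> y = m \<cdot> a\<rbrakk> \<Longrightarrow>
      h i \<cdot> y = g \<cdot> a" by metis
  have YO: "Y i \<in> Ob A" if "i \<in> I" for i by (rule GO[OF ev(2)[OF that]])
  obtain S \<iota> where S: "is_coproduct A I Y S \<iota>" using small_coproducts[of I Y] small_I YO by blast
  note \<iota> = coproduct_injection[OF S]
  have SO: "S \<in> Ob A" using S by (simp add: is_coproduct_def)
  \<comment> \<open>On the summand with index \<open>i\<close>, the cover \<open>p\<close> of
    \<open>B\<close> is the morphism \<open>ev i\<close> itself and \<open>H\<close> is its chosen
    extension \<open>h i\<close>.\<close>
  obtain p where p: "p \<in> Hom A S B" "\<And>i. i \<in> I \<Longrightarrow> p \<cdot> \<iota> i = ev i"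
    using coproduct_lift[OF S BO ev(1)] by blast
  obtain H where H: "H \<in> Hom A S L" "\<And>i. i \<in> I \<Longrightarrow> H \<cdot> \<iota> i = h i"
    using coproduct_lift[OF S LO h] by blast
  have p_epi: "epic A p"
    unfolding epic_def
  proof (intro conjI ballI impI)
    show "p \<in> Ar A" using p(1) by (simp add: Hom_def)
    fix Z v w assume "v \<in> Hom A (Cod A p) Z" "w \<in> Hom A (Cod A p) Z" and eq: "v \<cdot> p = w \<cdot> p"
    then have v: "v \<in> Hom A B Z" and w: "w \<in> Hom A B Z" using p(1) by (auto simp: Hom_def)
    show "v = w"
    proof (rule generating_eqI[OF \<G>(2) v w])
      fix G e assume "G \<in> \<G>" "e \<in> Hom A G B"
      then obtain i where i: "i \<in> I" "ev i = e" using index by blast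
      have "v \<cdot> (p \<cdot> \<iota> i) = w \<cdot> (p \<cdot> \<iota> i)"
        using Comp_assoc[OF \<iota>[OF i(1)] p(1) v] Comp_assoc[OF \<iota>[OF i(1)] p(1) w] eq by simp
      then show "v \<cdot> e = w \<cdot> e" using p(2)[OF i(1)] i(2) by simp
    qed
  qed
  \<comment> \<open>\<open>H\<close> has to vanish on the kernel of \<open>p\<close>; this is
    checked on morphisms \<open>x\<close> from generators.\<close>
  have relation: "H \<cdot> x = Zero A G L"
    if G: "G \<in> \<G>" and x: "x \<in> Hom A G S" and px: "p \<cdot> x = Zero A G B" for G x
  proof -
    obtain F y where F: "F \<subseteq> I" "finite F" and y: "\<And>i. i \<in> F \<Longrightarrow> y i \<in> Hom A G (Y i)"
      and xsum: "x = hom_sum G S (\<lambda>i. \<iota> i \<cdot> y i) F"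
      using finitely_generated_coproduct[OF assms(1) small_I S \<G>(3)[OF G] x] by blast
    have evF: "ev i \<in> Hom A (Y i) B" and \<iota>F: "\<iota> i \<in> Hom A (Y i) S" and hF: "h i \<in> Hom A (Y i) L"
      if "i \<in> F" for i using that F(1) ev(1) \<iota> h by auto
    have ey: "ev i \<cdot> y i \<in> Hom A G B" and \<iota>y: "\<iota> i \<cdot> y i \<in> Hom A G S"
      and hy: "h i \<cdot> y i \<in> Hom A G L" if "i \<in> F" for i
      using Comp_in_Hom[OF y[OF that]] evF[OF that] \<iota>F[OF that] hF[OF that] by auto
    have sum_ey: "hom_sum G B (\<lambda>i. ev i \<cdot> y i) F = Zero A G B"
    proof -
      have "hom_sum G B (\<lambda>i. p \<cdot> (\<iota> i \<cdot> y i)) F = Zero A G B"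
        using px Comp_hom_sum[OF p(1) GO[OF G] F(2) \<iota>y] by (simp add: xsum)
      moreover have "hom_sum G B (\<lambda>i. p \<cdot> (\<iota> i \<cdot> y i)) F = hom_sum G B (\<lambda>i. ev i \<cdot> y i) F"
      proof (rule hom_sum_cong[OF GO[OF G] BO ey])
        fix i assume i: "i \<in> F"
        then show "p \<cdot> (\<iota> i \<cdot> y i) = ev i \<cdot> y i"
          using Comp_assoc[OF y[OF i] \<iota>F[OF i] p(1)] p(2) F(1) by auto
      qed
      ultimately show ?thesis by simp
    qed
    have Hx: "H \<cdot> x = hom_sum G L (\<lambda>i. h i \<cdot> y i) F"
    proof -
      have "H \<cdot> x = hom_sum G L (\<lambda>i. H \<cdot> (\<iota> i \<cdot> y i)) F"
        unfolding xsum by (rule Comp_hom_sum[OF H(1) GO[OF G] F(2) \<iota>y])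
      also have "\<dots> = hom_sum G L (\<lambda>i. h i \<cdot> y i) F"
      proof (rule hom_sum_cong[OF GO[OF G] LO hy])
        fix i assume i: "i \<in> F"
        then show "H \<cdot> (\<iota> i \<cdot> y i) = h i \<cdot> y i"
          using Comp_assoc[OF y[OF i] \<iota>F[OF i] H(1)] H(2) F(1) by auto
      qed
      finally show ?thesis .
    qed
    \<comment> \<open>Composed with \<open>c\<close>, the terms \<open>ev i \<cdot> y i\<close> land
      in an object of \<open>\<C>\<close>, so they vanish jointly on some \<open>K\<close>, and
      \<open>k_dense\<close> allows \<open>H \<cdot> x\<close> to be tested there.\<close>
    obtain K k where k: "k \<in> Hom A K G"
      and ck: "\<And>i. i \<in> F \<Longrightarrow> (c \<cdot> (ev i \<cdot> y i)) \<cdot> k = Zero A K C"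
      and k_dense: "\<And>w. w \<in> Hom A G L \<Longrightarrow> w \<cdot> k = Zero A K L \<Longrightarrow> w = Zero A G L"
      by (rule torsion_free_common_kernel[OF \<C> tf C GO[OF G] LO F(2),
            where f = "\<lambda>i. c \<cdot> (ev i \<cdot> y i)"])
        (erule Comp_in_Hom[OF ey c], rule that)
    have KO: "K \<in> Ob A" by (rule Dom_Ob[OF k])
    \<comment> \<open>On \<open>K\<close> each term is killed by \<open>c\<close>, so it lifts to
      \<open>X\<close> through the kernel \<open>m\<close> of \<open>c\<close>.\<close>
    have "\<exists>z. z \<in> Hom A K X \<and> m \<cdot> z = (ev i \<cdot> y i) \<cdot> k" if i: "i \<in> F" for i
    proof -
      have "c \<cdot> ((ev i \<cdot> y i) \<cdot> k) = Zero A K C"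
        using ck[OF i] Comp_assoc[OF k ey[OF i] c] by simp
      then show ?thesis using kernel_lift[OF cm c Comp_in_Hom[OF k ey[OF i]]] Dm by metis
    qed
    then obtain z where z: "\<And>i. i \<in> F \<Longrightarrow> z i \<in> Hom A K X"
      and mz: "\<And>i. i \<in> F \<Longrightarrow> m \<cdot> z i = (ev i \<cdot> y i) \<cdot> k" by metis
    have zH: "hom_sum K X z F \<in> Hom A K X" by (rule hom_sum_in_Hom[OF KO XO z])
    \<comment> \<open>The lifts sum to zero because the relation holds in \<open>B\<close> and
      \<open>m\<close> is monic.\<close>
    have "m \<cdot> hom_sum K X z F = hom_sum K B (\<lambda>i. m \<cdot> z i) F"
      by (rule Comp_hom_sum[OF m KO F(2) z])
    also have "\<dots> = hom_sum K B (\<lambda>i. (ev i \<cdot> y i) \<cdot> k) F"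
      by (rule hom_sum_cong[OF KO BO Comp_in_Hom[OF k ey] mz])
    also have "\<dots> = hom_sum G B (\<lambda>i. ev i \<cdot> y i) F \<cdot> k"
      by (rule hom_sum_Comp[OF k BO F(2) ey, symmetric])
    also have "\<dots> = Zero A K B" using Zero_Comp[OF k BO] by (simp add: sum_ey)
    finally have z0: "hom_sum K X z F = Zero A K X"
      by (rule monic_Zero[OF m m_mono zH])
    have "(H \<cdot> x) \<cdot> k = hom_sum K L (\<lambda>i. (h i \<cdot> y i) \<cdot> k) F"
      unfolding Hx by (rule hom_sum_Comp[OF k LO F(2) hy])
    also have "\<dots> = hom_sum K L (\<lambda>i. g \<cdot> z i) F"
    proof (rule hom_sum_cong[OF KO LO Comp_in_Hom[OF z g]])
      fix i assume i: "i \<in> F"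
      then have iI: "i \<in> I" using F(1) by blast
      \<comment> \<open>The pair \<open>y i \<cdot> k\<close>, \<open>z i\<close> is a generalized
        element of the pullback of \<open>m\<close> along \<open>ev i\<close>, where
        \<open>h i\<close> agrees with \<open>g\<close>.\<close>
      have "ev i \<cdot> (y i \<cdot> k) = m \<cdot> z i" using mz[OF i] Comp_assoc[OF k y[OF i] evF[OF i]] by simp
      from h_ext[OF iI Comp_in_Hom[OF k y[OF i]] z[OF i] this]
      show "(h i \<cdot> y i) \<cdot> k = g \<cdot> z i" using Comp_assoc[OF k y[OF i] hF[OF i]] by simp
    qed
    also have "\<dots> = g \<cdot> hom_sum K X z F" by (rule Comp_hom_sum[OF g KO F(2) z, symmetric])
    also have "\<dots> = Zero A K L" using Comp_Zero[OF g KO] by (simp add: z0)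
    finally show ?thesis by (rule k_dense[OF Comp_in_Hom[OF x H(1)]])
  qed
  obtain n where n: "is_kernel A p n" using kernel_exists[OF p(1)] .
  note nH = kernel_in_Hom[OF n p(1)]
  \<comment> \<open>Vanishing on the kernel of the epimorphism \<open>p\<close> makes
    \<open>H\<close> descend to \<open>B\<close>.\<close>
  have "H \<cdot> n = Zero A (Dom A n) L"
  proof (rule generating_eqI[OF \<G>(2) Comp_in_Hom[OF nH H(1)] Zero_in_Hom[OF Dom_Ob[OF nH] LO]])
    fix G e assume G: "G \<in> \<G>" and e: "e \<in> Hom A G (Dom A n)"
    have "p \<cdot> (n \<cdot> e) = Zero A G B"
      using Comp_assoc[OF e nH p(1)] kernel_Comp[OF n p(1)] Zero_Comp[OF e BO] by simp
    from relation[OF G Comp_in_Hom[OF e nH] this]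
    show "(H \<cdot> n) \<cdot> e = Zero A (Dom A n) L \<cdot> e"
      using Comp_assoc[OF e nH H(1)] Zero_Comp[OF e LO] by simp
  qed
  moreover have "Cod A p = B" using p(1) by (simp add: Hom_def)
  ultimately obtain r where r: "r \<in> Hom A B L" "r \<cdot> p = H"
    using cokernel_factor[OF epic_is_cokernel_of_kernel[OF p(1) p_epi n] nH H(1)] by metis
  have "r \<cdot> m = g"
  proof (rule generating_eqI[OF \<G>(2) Comp_in_Hom[OF m r(1)] g])
    fix G e assume G: "G \<in> \<G>" and e: "e \<in> Hom A G X"
    \<comment> \<open>The morphism \<open>m \<cdot> e\<close> is itself among the
      \<open>ev i\<close>; evaluating its extension at the identity of \<open>G\<close> gives
      \<open>g \<cdot> e\<close>.\<close>
    obtain i where i: "i \<in> I" "Y i = G" "ev i = m \<cdot> e" using index[OF G Comp_in_Hom[OF e m]] by blast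
    have Ide: "Ide A G \<in> Hom A G (Y i)" using i(2) Ide_in_Hom[OF GO[OF G]] by simp
    have hi: "h i \<in> Hom A G L" using h[OF i(1)] i(2) by simp
    have "ev i \<cdot> Ide A G = m \<cdot> e" using i(3) Comp_Ide[OF Comp_in_Hom[OF e m]] by simp
    from h_ext[OF i(1) Ide e this] have "h i = g \<cdot> e" using Comp_Ide[OF hi] by simp
    moreover have "h i = r \<cdot> ev i"
      using Comp_assoc[OF \<iota>[OF i(1)] p(1) r(1)] r(2) H(2)[OF i(1)] p(2)[OF i(1)] by simp
    ultimately show "(r \<cdot> m) \<cdot> e = g \<cdot> e" using i(3) Comp_assoc[OF e m r(1)] by simp
  qed
  then show thesis using that r(1) by blast
qed

text \<open>A \<open>\<C>\<close>-isomorphism is an epimorphism with kernel in \<open>\<C>\<close>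
  followed by a monomorphism with cokernel in \<open>\<C>\<close>. The vanishing of morphisms from
  \<open>\<C>\<close> to \<open>L\<close> handles the first factor,
  \<open>extend_along_generators\<close> the second.\<close>

lemma serre_closed_if_closed_on_kernels:
  assumes "universe U" and \<C>: "serre_subcategory A \<C>" and L: "L \<in> Ob A"
    and \<G>: "small U \<G>" "generating A \<G>" "\<And>G. G \<in> \<G> \<Longrightarrow> finitely_generated U A G"
    and closed: "\<And>G C f k. \<lbrakk>G \<in> \<G>; C \<in> \<C>; f \<in> Hom A G C; is_kernel A f k\<rbrakk> \<Longrightarrow> hom_map_iso A k L"
  shows "serre_closed A \<C> L"
  unfolding serre_closed_def
proof (intro conjI allI ballI impI L)
  have tf': "f = Zero A C L" if C: "C \<in> \<C>" and f: "f \<in> Hom A C L" for C f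
  proof (rule generating_eqI[OF \<G>(2) f Zero_in_Hom[OF Dom_Ob[OF f] L]])
    fix G e assume G: "G \<in> \<G>" and e: "e \<in> Hom A G C"
    obtain k where k: "is_kernel A e k" using kernel_exists[OF e] .
    note kH = kernel_in_Hom[OF k e]
    have fe: "(f \<cdot> e) \<cdot> k = Zero A (Dom A k) L"
      using Comp_assoc[OF kH e f] kernel_Comp[OF k e] Comp_Zero[OF f Dom_Ob[OF kH]] by simp
    \<comment> \<open>Both \<open>f \<cdot> e\<close> and zero extend the zero morphism along
      \<open>k\<close>, so uniqueness identifies them.\<close>
    have "\<exists>!w. w \<in> Hom A G L \<and> w \<cdot> k = Zero A (Dom A k) L"
      using closed[OF G C e k] Zero_in_Hom[OF Dom_Ob[OF kH] L]
      unfolding hom_map_iso_iff[OF kH L] by blast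
    then have "f \<cdot> e = Zero A G L"
      using fe Comp_in_Hom[OF e f] Zero_in_Hom[OF Dom_Ob[OF e] L] Zero_Comp[OF kH L]
      by (metis (no_types, lifting))
    then show "f \<cdot> e = Zero A C L \<cdot> e" using Zero_Comp[OF e L] by simp
  qed
  then have tf: "\<forall>C\<in>\<C>. \<forall>f\<in>Hom A C L. f = Zero A C L" by blast
  fix X B u assume u: "u \<in> Hom A X B" and iso: "serre_iso A \<C> u"
  obtain n c where n: "is_kernel A u n" "Dom A n \<in> \<C>" and c: "is_cokernel A u c" "Cod A c \<in> \<C>"
    using iso by (auto simp: serre_iso_def)
  note nH = kernel_in_Hom[OF n(1) u]
  note cH = cokernel_in_Hom[OF c(1) u]
  obtain p where p: "is_cokernel A n p" using cokernel_exists[OF nH] .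
  note pH = cokernel_in_Hom[OF p nH]
  note p_epi = cokernel_epic[OF p nH]
  obtain m where m: "m \<in> Hom A (Cod A p) B" "m \<cdot> p = u" "monic A m"
    using image_factorization[OF u n(1) p] .
  \<comment> \<open>Since \<open>p\<close> is epic, \<open>m\<close> and \<open>u\<close> are
    annihilated by the same morphisms and share their cokernel.\<close>
  have cm: "is_cokernel A m c"
    unfolding is_cokernel_def
  proof (intro conjI ballI impI)
    have "(c \<cdot> m) \<cdot> p = Zero A X (Cod A c)"
      using Comp_assoc[OF pH m(1) cH] m(2) cokernel_Comp[OF c(1) u] by simp
    then show "c \<cdot> m = Zero A (Dom A m) (Cod A c)"
      using epic_Zero[OF pH p_epi Comp_in_Hom[OF m(1) cH]] m(1) by (simp add: Hom_def)
    show "m \<in> Ar A" "c \<in> Ar A" "Dom A c = Cod A m" using m(1) cH by (auto simp: Hom_def)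
    fix Z h assume "Z \<in> Ob A" "h \<in> Hom A (Cod A m) Z" and hm: "h \<cdot> m = Zero A (Dom A m) Z"
    then have h: "h \<in> Hom A B Z" and "h \<cdot> m = Zero A (Cod A p) Z" using m(1) by (auto simp: Hom_def)
    then have "h \<cdot> u = Zero A X Z"
      using Comp_assoc[OF pH m(1) h] m(2) Zero_Comp[OF pH \<open>Z \<in> Ob A\<close>] by simp
    then show "\<exists>!g. g \<in> Hom A (Cod A c) Z \<and> g \<cdot> c = h" by (rule cokernel_ex1[OF c(1) u h])
  qed
  have mc: "is_kernel A c m" by (rule monic_is_kernel[OF m(1,3) cm])
  have Dm: "Dom A m = Cod A p" using m(1) by (simp add: Hom_def)
  have inj: "w = w'" if w: "w \<in> Hom A B L" and w': "w' \<in> Hom A B L" and eq: "w \<cdot> u = w' \<cdot> u" for w w'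
  proof -
    \<comment> \<open>The difference kills \<open>u\<close>, so it factors through the cokernel
      object of \<open>u\<close>, which lies in \<open>\<C>\<close>.\<close>
    obtain d where d: "d \<in> Hom A B L" "Add A d w' = w" using difference[OF w w'] .
    have "Add A (d \<cdot> u) (w' \<cdot> u) = w' \<cdot> u" using Comp_Add_left[OF u d(1) w'] d(2) eq by simp
    then have "d \<cdot> u = Zero A X L" by (rule Zero_eqI[OF Comp_in_Hom[OF u d(1)] Comp_in_Hom[OF u w']])
    then obtain d' where d': "d' \<in> Hom A (Cod A c) L" "d' \<cdot> c = d"
      using cokernel_factor[OF c(1) u d(1)] by blast
    have "d = Zero A B L" using tf'[OF c(2) d'(1)] d'(2) Zero_Comp[OF cH L] by simp
    then show "w = w'" using d(2) Add_Zero[OF w'] by simp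
  qed
  have surj: "\<exists>w. w \<in> Hom A B L \<and> w \<cdot> u = v" if v: "v \<in> Hom A X L" for v
  proof -
    \<comment> \<open>The kernel object of \<open>u\<close> lies in \<open>\<C>\<close>, so
      \<open>v\<close> vanishes on it and descends to the image of \<open>u\<close>.\<close>
    have "v \<cdot> n = Zero A (Dom A n) L" by (rule tf'[OF n(2) Comp_in_Hom[OF nH v]])
    then obtain g where g: "g \<in> Hom A (Cod A p) L" "g \<cdot> p = v"
      using cokernel_factor[OF p nH v] by blast
    show ?thesis
    proof (rule extend_along_generators[OF assms(1) \<C> tf \<G> c(2) cH m(1) mc g(1)])
      fix r assume r: "r \<in> Hom A B L" "r \<cdot> m = g"
      then have "r \<cdot> u = v" using Comp_assoc[OF pH m(1) r(1)] m(2) g(2) by simp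
      then show ?thesis using r(1) by blast
    next
      fix G e assume G: "G \<in> \<G>" and e: "e \<in> Hom A G B"
      note ce = Comp_in_Hom[OF e cH]
      \<comment> \<open>As \<open>m\<close> is the kernel of \<open>c\<close>, the kernel
        \<open>k\<close> of \<open>c \<cdot> e\<close> together with \<open>b\<close> is the
        pullback of \<open>m\<close> along \<open>e\<close>; \<open>closed\<close> extends
        \<open>g \<cdot> b\<close> from it to \<open>G\<close>.\<close>
      obtain k where k: "is_kernel A (c \<cdot> e) k" using kernel_exists[OF ce] .
      note kH = kernel_in_Hom[OF k ce]
      have "c \<cdot> (e \<cdot> k) = Zero A (Dom A k) (Cod A c)"
        using Comp_assoc[OF kH e cH] kernel_Comp[OF k ce] by simp
      then obtain b where b: "b \<in> Hom A (Dom A k) (Cod A p)" "m \<cdot> b = e \<cdot> k"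
        using kernel_lift[OF mc cH Comp_in_Hom[OF kH e]] Dm by metis
      obtain h where h: "h \<in> Hom A G L" "h \<cdot> k = g \<cdot> b"
        using closed[OF G c(2) ce k] Comp_in_Hom[OF b(1) g(1)]
        unfolding hom_map_iso_iff[OF kH L] by blast
      show "\<exists>h\<in>Hom A G L. \<forall>W y a. y \<in> Hom A W G \<longrightarrow> a \<in> Hom A W (Cod A p) \<longrightarrow>
        e \<cdot> y = m \<cdot> a \<longrightarrow> h \<cdot> y = g \<cdot> a"
      proof (intro bexI[OF _ h(1)] allI impI)
        fix W y a assume y: "y \<in> Hom A W G" and a: "a \<in> Hom A W (Cod A p)" and eq: "e \<cdot> y = m \<cdot> a"
        \<comment> \<open>A generalized element \<open>y\<close>, \<open>a\<close> of the pullback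
          factors through \<open>k\<close> by some \<open>y'\<close>, and monicity of
          \<open>m\<close> gives \<open>a\<close> as \<open>b \<cdot> y'\<close>.\<close>
        have "(c \<cdot> e) \<cdot> y = c \<cdot> (m \<cdot> a)" using Comp_assoc[OF y e cH] eq by simp
        also have "\<dots> = Zero A W (Cod A c)"
          using Comp_assoc[OF a m(1) cH] cokernel_Comp[OF cm m(1)] Zero_Comp[OF a Cod_Ob[OF cH]] by simp
        finally obtain y' where y': "y' \<in> Hom A W (Dom A k)" "k \<cdot> y' = y"
          using kernel_lift[OF k ce y] by metis
        have "m \<cdot> (b \<cdot> y') = e \<cdot> (k \<cdot> y')"
          using Comp_assoc[OF y'(1) b(1) m(1)] b(2) Comp_assoc[OF y'(1) kH e] by simp
        then have "b \<cdot> y' = a"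
          using monicD[OF m(3,1) Comp_in_Hom[OF y'(1) b(1)] a] y'(2) eq by simp
        then show "h \<cdot> y = g \<cdot> a"
          using Comp_assoc[OF y'(1) kH h(1)] Comp_assoc[OF y'(1) b(1) g(1)] y'(2) h(2) by simp
      qed
    qed
  qed
  show "hom_map_iso A u L"
    unfolding hom_map_iso_iff[OF u L]
  proof
    fix v assume "v \<in> Hom A X L"
    then obtain w where "w \<in> Hom A B L" "w \<cdot> u = v" using surj by blast
    then show "\<exists>!w. w \<in> Hom A B L \<and> w \<cdot> u = v" using inj by (intro ex1I[of _ w]) auto
  qed
qed

end

section \<open>Reduction to \<open>\<C>\<close>-isomorphisms between finitely generated
  objects\<close>

theorem proposition4p4:
  fixes A :: "('o, 'm) ab_category" and \<C> :: "'o set" and L :: 'o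
  assumes "universe TYPE('u)"
    and "locally_noetherian_category TYPE('u) A"
    and "serre_subcategory A \<C>"
    and "L \<in> Ob A"
  shows "serre_closed A \<C> L \<longleftrightarrow>
    (\<forall>A' B'. \<forall>u' \<in> Hom A A' B'.
      finitely_generated TYPE('u) A A' \<and> finitely_generated TYPE('u) A B' \<and>
      serre_iso A \<C> u' \<longrightarrow> hom_map_iso A u' L)"
proof
  assume "serre_closed A \<C> L"
  then show "\<forall>A' B'. \<forall>u' \<in> Hom A A' B'.
      finitely_generated TYPE('u) A A' \<and> finitely_generated TYPE('u) A B' \<and>
      serre_iso A \<C> u' \<longrightarrow> hom_map_iso A u' L"
    unfolding serre_closed_def by blast
next
  assume closed: "\<forall>A' B'. \<forall>u' \<in> Hom A A' B'.
      finitely_generated TYPE('u) A A' \<and> finitely_generated TYPE('u) A B' \<and>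
      serre_iso A \<C> u' \<longrightarrow> hom_map_iso A u' L"
  interpret locally_noetherian_category "TYPE('u)" A by (rule assms(2))
  obtain \<G> where \<G>: "small TYPE('u) \<G>" "generating A \<G>"
    and noeth: "\<And>G. G \<in> \<G> \<Longrightarrow> noetherian TYPE('u) A G" using noetherian_generators by blast
  \<comment> \<open>Kernels of morphisms out of a generator are among these subobjects, and the
    identity accounts for the generator itself.\<close>
  have sub: "finitely_generated TYPE('u) A K"
    if "G \<in> \<G>" "k \<in> Hom A K G" "monic A k" for G K k
    using noeth[OF that(1)] that(2,3) by (auto simp: noetherian_def Hom_def)
  have fg: "finitely_generated TYPE('u) A G" if "G \<in> \<G>" for G
  proof -
    have "G \<in> Ob A" using that \<G>(2) by (auto simp: generating_def)
    then show ?thesis using sub[OF that Ide_in_Hom monic_Ide] by blast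
  qed
  show "serre_closed A \<C> L"
  proof (rule serre_closed_if_closed_on_kernels[OF assms(1,3,4) \<G> fg])
    fix G C f k assume G: "G \<in> \<G>" and C: "C \<in> \<C>" and f: "f \<in> Hom A G C" and k: "is_kernel A f k"
    note kH = kernel_in_Hom[OF k f]
    show "hom_map_iso A k L"
      using closed kH sub[OF G kH kernel_monic[OF k f]] fg[OF G]
        serre_iso_kernel[OF assms(3) f C k] by blast
  qed
qed

end
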